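(* Let $S$ be a finite semigroup. If every subsemigroup of $S$ generated by two elements is nilpotent in the sense of Malcev (i.e. the upper non-nilpotent graph $\mathcal{N}_S$ is empty, having no edges), then $S$ is positively Engel.
   Context: For a semigroup $S$, $S^1$ denotes $S$ if $S$ has an identity, and otherwise $S$ with an identity $1$ adjoined. For elements $x,y\in S$ and $z_1,z_2,\ldots\in S^1$ define recursively $\lambda_0=x$, $\rho_0=y$, $\lambda_{n+1}=\lambda_n z_{n+1}\rho_n$, $\rho_{n+1}=\rho_n z_{n+1}\lambda_n$; write $\lambda_n=\lambda_n(x,y,z_1,\ldots,z_n)$ and $\rho_n=\rho_n(x,y,z_1,\ldots,z_n)$. A semigroup $S$ is nilpotent (in the sense of Malcev) if there is a positive integer $n$ with $\lambda_n(a,b,c_1,\ldots,c_n)=\rho_n(a,b,c_1,\ldots,c_n)$ for all $a,b\in S$ and $c_1,\ldots,c_n\in S^1$. The semigroup $S$ is positively Engel if, for some $n\ge 2$, $\lambda_n(a,b,1,1,c,c^2,\ldots,c^{n-2})=\rho_n(a,b,1,1,c,c^2,\ldots,c^{n-2})$ for all $a,b\in S$ and $c\in S^1$. The upper non-nilpotent graph $\mathcal{N}_S$ has vertex set $S$, with an edge between distinct $x,y$ if and only if the subsemigroup $\langle x,y\rangle$ is not nilpotent. *)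

theory Defs
  imports Main "HOL.Hull"
begin

text \<open>
  A semigroup is a nonempty multiplicatively closed set of elements of a type of class
  \<^class>\<open>semigroup_mult\<close>, so that a semigroup and its subsemigroups are handled uniformly.
\<close>

definition subsemigroup :: "'a::semigroup_mult set \<Rightarrow> bool" where
  "subsemigroup T \<longleftrightarrow> T \<noteq> {} \<and> (\<forall>x\<in>T. \<forall>y\<in>T. x * y \<in> T)"

abbreviation generated :: "'a::semigroup_mult set \<Rightarrow> 'a set" where
  "generated X \<equiv> subsemigroup hull X"

definition is_identity :: "'a::semigroup_mult set \<Rightarrow> 'a \<Rightarrow> bool" where
  "is_identity T e \<longleftrightarrow> e \<in> T \<and> (\<forall>x\<in>T. e * x = x \<and> x * e = x)"

datatype 'a adjoin = One | Elt 'a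

instantiation adjoin :: (semigroup_mult) monoid_mult
begin

definition one_adjoin :: "'a adjoin" where
  "one_adjoin = One"

fun times_adjoin :: "'a adjoin \<Rightarrow> 'a adjoin \<Rightarrow> 'a adjoin" where
  "times_adjoin One v = v"
| "times_adjoin u One = u"
| "times_adjoin (Elt x) (Elt y) = Elt (x * y)"

instance
proof
  fix a b c :: "'a adjoin"
  show "a * b * c = a * (b * c)"
    by (cases a; cases b; cases c) (simp_all add: mult.assoc)
  show "1 * a = a" "a * 1 = a"
    by (cases a; simp add: one_adjoin_def)+
qed

end

text \<open>
  \<open>with_one T\<close> is the monoid $T^1$: the new element \<^const>\<open>One\<close> belongs to it only
  if \<open>T\<close> has no identity of its own. \<open>the_one T\<close> is the identity of $T^1$; it differs from
  the identity \<^const>\<open>One\<close> of the ambient type when \<open>T\<close> has an identity.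
\<close>

definition with_one :: "'a::semigroup_mult set \<Rightarrow> 'a adjoin set" where
  "with_one T = (if \<exists>e. is_identity T e then Elt ` T else insert One (Elt ` T))"

definition the_one :: "'a::semigroup_mult set \<Rightarrow> 'a adjoin" where
  "the_one T = (if \<exists>e. is_identity T e then Elt (THE e. is_identity T e) else One)"

text \<open>
  The argument \<open>z\<close> is a sequence of which only the terms \<open>z 1, \<dots>, z n\<close> are used by
  \<open>malcev_lambda x y z n\<close> and \<open>malcev_rho x y z n\<close>.
\<close>

fun malcev_lambda malcev_rho :: "'m::semigroup_mult \<Rightarrow> 'm \<Rightarrow> (nat \<Rightarrow> 'm) \<Rightarrow> nat \<Rightarrow> 'm" where
  "malcev_lambda x y z 0 = x"
| "malcev_rho x y z 0 = y"
| "malcev_lambda x y z (Suc n) = malcev_lambda x y z n * z (Suc n) * malcev_rho x y z n"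
| "malcev_rho x y z (Suc n) = malcev_rho x y z n * z (Suc n) * malcev_lambda x y z n"

definition nilpotent :: "'a::semigroup_mult set \<Rightarrow> bool" where
  "nilpotent T \<longleftrightarrow>
    (\<exists>n>0. \<forall>a\<in>T. \<forall>b\<in>T. \<forall>c. (\<forall>i\<in>{1..n}. c i \<in> with_one T) \<longrightarrow>
      malcev_lambda (Elt a) (Elt b) c n = malcev_rho (Elt a) (Elt b) c n)"

text \<open>The sequence $1, 1, c, c^2, c^3, \dots$, indexed from 1.\<close>

definition engel_seq :: "'a::semigroup_mult set \<Rightarrow> 'a adjoin \<Rightarrow> nat \<Rightarrow> 'a adjoin" where
  "engel_seq T c i = (if i \<le> 2 then the_one T else c ^ (i - 2))"

definition positively_engel :: "'a::semigroup_mult set \<Rightarrow> bool" where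
  "positively_engel T \<longleftrightarrow>
    (\<exists>n\<ge>2. \<forall>a\<in>T. \<forall>b\<in>T. \<forall>c\<in>with_one T.
      malcev_lambda (Elt a) (Elt b) (engel_seq T c) n = malcev_rho (Elt a) (Elt b) (engel_seq T c) n)"

definition upper_non_nilpotent_edges :: "'a::semigroup_mult set \<Rightarrow> 'a set set" where
  "upper_non_nilpotent_edges S =
    {{x, y} | x y. x \<in> S \<and> y \<in> S \<and> x \<noteq> y \<and> \<not> nilpotent (generated {x, y})}"

lemma nilpotent_generated_singleton: "nilpotent (generated {x})"
proof -
  have x_comm: "y * x = x * y" if "y \<in> generated {x}" for y
  proof -
    have "subsemigroup {y. y * x = x * y}"
      unfolding subsemigroup_def by (auto simp: mult.assoc) (metis mult.assoc)
    then have "generated {x} \<subseteq> {y. y * x = x * y}"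
      by (intro hull_minimal) auto
    with that show ?thesis by auto
  qed
  have comm: "z * y = y * z" if "y \<in> generated {x}" "z \<in> generated {x}" for y z
  proof -
    have "subsemigroup {z. z * y = y * z}"
      unfolding subsemigroup_def by (auto simp: mult.assoc) (metis mult.assoc)
    then have "generated {x} \<subseteq> {z. z * y = y * z}"
      by (intro hull_minimal) (auto simp: x_comm that(1))
    with that show ?thesis by auto
  qed
  have "Elt a * c * Elt b = Elt b * c * Elt a"
    if "a \<in> generated {x}" "b \<in> generated {x}" "c \<in> with_one (generated {x})" for a b c
    using that by (cases c) (auto simp: with_one_def comm mult.assoc split: if_splits,
      (metis comm mult.assoc)+)
  then show ?thesis
    unfolding nilpotent_def by (intro exI[of _ 1]) auto
qed

lemma upper_non_nilpotent_edges_empty_iff: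
  "upper_non_nilpotent_edges S = {} \<longleftrightarrow> (\<forall>x\<in>S. \<forall>y\<in>S. nilpotent (generated {x, y}))"
  using nilpotent_generated_singleton unfolding upper_non_nilpotent_edges_def by fastforce

end

(*  If S is not positively Engel, then by finiteness some triple a, b, c gives lambda_n \<noteq> rho_n for
    all n, and the sequence (lambda_n, rho_n, c^n) is eventually periodic. All lambda_n and rho_n in
    the period are then regular elements of a single J-class. Two distinct idempotents generating
    a left or right zero band do not generate a nilpotent semigroup, so the idempotents in the
    R-classes and L-classes of these elements are unique. Let e be the idempotent power of c and
    d = c e. Comparing idempotents leaves two idempotents f and g with f d = d g and g d = d f.
    If f \<noteq> g, then f and d generate a non-nilpotent semigroup. If f = g, everything takes place
    in the group of units of f S f. All two-generated subgroups of this finite group are nilpotent,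
    so elements of coprime order commute, which makes the group nilpotent by Sylow's theorem;
    as lambda_(n+1) rho_(n+1)^-1 is the commutator of lambda_n rho_n^-1 with another element,
    lambda_n = rho_n for some n. *)

theory Submission
  imports Defs "HOL-Algebra.Sylow" "HOL-Algebra.Group_Action" "HOL-Algebra.Multiplicative_Group"
begin

section \<open>Finite groups in which elements of coprime order commute\<close>

definition commutator :: "('a, 'b) monoid_scheme \<Rightarrow> 'a \<Rightarrow> 'a \<Rightarrow> 'a" where
  "commutator G x y = x \<otimes>\<^bsub>G\<^esub> y \<otimes>\<^bsub>G\<^esub> inv\<^bsub>G\<^esub> x \<otimes>\<^bsub>G\<^esub> inv\<^bsub>G\<^esub> y"

text \<open>For normal \<open>N\<close> this is the preimage of the centre of
  \<open>G Mod N\<close>, so iterating it from the trivial subgroup yields the upper central series.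
  Commutators keep every term inside the type of \<open>G\<close>, whereas iterated quotients would
  change the type at each step.\<close>

definition central_mod :: "('a, 'b) monoid_scheme \<Rightarrow> 'a set \<Rightarrow> 'a set" where
  "central_mod G N = {u \<in> carrier G. \<forall>v\<in>carrier G. commutator G u v \<in> N}"

abbreviation upper_central :: "('a, 'b) monoid_scheme \<Rightarrow> nat \<Rightarrow> 'a set" where
  "upper_central G n \<equiv> (central_mod G ^^ n) {\<one>\<^bsub>G\<^esub>}"

context group
begin

text \<open>Quotient products stay folded, so that group laws and homomorphism rules apply to them
  instead of rules about products of cosets.\<close>

declare mult_FactGroup [simp del] one_FactGroup [simp del]

lemma commutator_closed [simp, intro]:
  "\<lbrakk>x \<in> carrier G; y \<in> carrier G\<rbrakk> \<Longrightarrow> commutator G x y \<in> carrier G"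
  by (simp add: commutator_def)

lemma commutator_swap:
  assumes "x \<in> carrier G" "y \<in> carrier G"
  shows "x \<otimes> y = commutator G x y \<otimes> (y \<otimes> x)"
  using assms by (simp add: commutator_def m_assoc flip: m_assoc[of "inv y" y])

lemma commutator_eq_one_iff:
  assumes "x \<in> carrier G" "y \<in> carrier G"
  shows "commutator G x y = \<one> \<longleftrightarrow> x \<otimes> y = y \<otimes> x"
  using commutator_swap[OF assms] assms
  by (metis commutator_closed l_one m_closed r_cancel_one')

lemma pow_eq_one_coprime:
  fixes m l :: nat
  assumes "x \<in> carrier G" "x [^] m = \<one>" "x [^] l = \<one>" "coprime m l"
  shows "x = \<one>"
  using assms by (metis coprime_common_divisor_nat ord_eq_1 pow_eq_id)

lemma inv_commute:
  assumes "a \<in> carrier G" "b \<in> carrier G" "a \<otimes> b = b \<otimes> a"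
  shows "inv a \<otimes> b = b \<otimes> inv a"
proof -
  have "inv a \<otimes> b = inv a \<otimes> (b \<otimes> a) \<otimes> inv a"
    using assms(1,2) by (simp add: m_assoc)
  also have "\<dots> = b \<otimes> inv a"
    using assms(1,2) by (simp flip: assms(3) m_assoc)
  finally show ?thesis .
qed

lemma mult_commute:
  assumes "a \<in> carrier G" "b \<in> carrier G" "c \<in> carrier G" "a \<otimes> c = c \<otimes> a" "b \<otimes> c = c \<otimes> b"
  shows "a \<otimes> b \<otimes> c = c \<otimes> (a \<otimes> b)"
proof -
  have "a \<otimes> b \<otimes> c = a \<otimes> (c \<otimes> b)"
    using assms by (simp add: m_assoc)
  also have "\<dots> = c \<otimes> (a \<otimes> b)"
    using assms by (simp flip: m_assoc)
  finally show ?thesis .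
qed

text \<open>Each factor \<open>x\<close> that moves past \<open>y\<close> leaves one
  \<open>w\<close> behind; as \<open>w\<close> commutes with \<open>x\<close>, these collect in
  front.\<close>

lemma commutator_pow_left:
  fixes k :: nat
  assumes "x \<in> carrier G" "y \<in> carrier G" "w \<in> carrier G"
    and "x \<otimes> y = w \<otimes> (y \<otimes> x)" "w \<otimes> x = x \<otimes> w"
  shows "x [^] k \<otimes> y = w [^] k \<otimes> (y \<otimes> x [^] k)"
proof (induction k)
  case (Suc k)
  have wx: "x [^] k \<otimes> w = w \<otimes> x [^] k"
    using assms by (simp add: group_commutes_pow)
  have "x [^] Suc k \<otimes> y = x [^] k \<otimes> (x \<otimes> y)"
    using assms(1-3) by (simp add: m_assoc)
  also have "\<dots> = w \<otimes> (x [^] k \<otimes> y) \<otimes> x"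
    using assms(1-3) wx by (simp add: assms(4) flip: m_assoc)
  also have "\<dots> = w [^] Suc k \<otimes> (y \<otimes> x [^] Suc k)"
    using assms(1-3) by (simp add: Suc.IH group_commutes_pow[of w w] flip: m_assoc)
  finally show ?case .
qed (use assms in auto)

lemma commutator_pow_right:
  fixes k :: nat
  assumes "x \<in> carrier G" "y \<in> carrier G" "w \<in> carrier G"
    and "x \<otimes> y = w \<otimes> (y \<otimes> x)" "w \<otimes> y = y \<otimes> w"
  shows "x \<otimes> y [^] k = w [^] k \<otimes> (y [^] k \<otimes> x)"
proof (induction k)
  case (Suc k)
  have wy: "y [^] k \<otimes> w = w \<otimes> y [^] k"
    using assms by (simp add: group_commutes_pow)
  have "x \<otimes> y [^] Suc k = w [^] k \<otimes> y [^] k \<otimes> (x \<otimes> y)"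
    using assms(1-3) by (simp add: Suc.IH m_assoc flip: m_assoc[of x])
  also have "\<dots> = w [^] k \<otimes> (y [^] k \<otimes> w) \<otimes> (y \<otimes> x)"
    using assms(1-3) by (simp add: assms(4) m_assoc)
  also have "\<dots> = w [^] Suc k \<otimes> (y [^] Suc k \<otimes> x)"
    using assms(1-3) wy by (simp add: m_assoc)
  finally show ?case .
qed (use assms in auto)

text \<open>A central commutator is multiplicative in powers of either argument. Hence its powers to
  \<open>m\<close> and to \<open>l\<close> are commutators with the identity, and coprimality makes
  it trivial.\<close>

lemma coprime_pow_commute_if_central:
  fixes m l :: nat
  assumes xy: "x \<in> carrier G" "y \<in> carrier G"
    and central: "\<And>v. v \<in> carrier G \<Longrightarrow> commutator G x y \<otimes> v = v \<otimes> commutator G x y"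
    and "x [^] m = \<one>" "y [^] l = \<one>" "coprime m l"
  shows "commutator G x y = \<one>"
proof -
  let ?w = "commutator G x y"
  have "y = ?w [^] m \<otimes> y"
    using commutator_pow_left[OF xy _ commutator_swap[OF xy] central, of m] assms by simp
  moreover have "x = ?w [^] l \<otimes> x"
    using commutator_pow_right[OF xy _ commutator_swap[OF xy] central, of l] assms by simp
  ultimately have "?w [^] m = \<one>" "?w [^] l = \<one>"
    using xy r_cancel_one'[of y "?w [^] m"] r_cancel_one'[of x "?w [^] l"] by simp_all
  then show ?thesis
    using pow_eq_one_coprime xy \<open>coprime m l\<close> by blast
qed

section \<open>Quotients, relative centres and the upper central series\<close>

lemma group_hom_Mod:
  assumes "N \<lhd> G"
  shows "group_hom G (G Mod N) (\<lambda>a. N #> a)"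
  using assms by (simp add: group_hom_def group_hom_axioms_def is_group
      normal.factorgroup_is_group normal.r_coset_hom_Mod)

lemma r_coset_eq_one_iff:
  assumes "N \<lhd> G" "a \<in> carrier G"
  shows "N #> a = \<one>\<^bsub>G Mod N\<^esub> \<longleftrightarrow> a \<in> N"
  unfolding one_FactGroup
  using assms normal_imp_subgroup coset_join1 coset_join2 by blast

lemma commutator_in_normal_iff:
  assumes "N \<lhd> G" "u \<in> carrier G" "v \<in> carrier G"
  shows "commutator G u v \<in> N \<longleftrightarrow>
    (N #> u) \<otimes>\<^bsub>G Mod N\<^esub> (N #> v) = (N #> v) \<otimes>\<^bsub>G Mod N\<^esub> (N #> u)"
proof -
  interpret Q: group_hom G "G Mod N" "\<lambda>a. N #> a"
    using assms(1) by (rule group_hom_Mod)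
  have "commutator G u v \<in> N \<longleftrightarrow> N #> commutator G u v = \<one>\<^bsub>G Mod N\<^esub>"
    using assms by (simp add: r_coset_eq_one_iff)
  also have "N #> commutator G u v = commutator (G Mod N) (N #> u) (N #> v)"
    using assms unfolding commutator_def by simp
  finally show ?thesis
    using assms by (simp add: Q.H.commutator_eq_one_iff)
qed

lemma central_mod_iff:
  assumes "N \<lhd> G"
  shows "u \<in> central_mod G N \<longleftrightarrow> u \<in> carrier G \<and> (\<forall>W\<in>carrier (G Mod N).
    (N #> u) \<otimes>\<^bsub>G Mod N\<^esub> W = W \<otimes>\<^bsub>G Mod N\<^esub> (N #> u))"
  using assms by (auto simp: central_mod_def commutator_in_normal_iff carrier_FactGroup)

text \<open>Both claims are pulled back from the quotient by \<open>central_mod_iff\<close>: there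
  the central elements form a normal subgroup, and elements of \<open>N\<close> become the
  identity.\<close>

lemma normal_central_mod:
  assumes N: "N \<lhd> G"
  shows "central_mod G N \<lhd> G" "N \<subseteq> central_mod G N"
proof -
  interpret Q: group_hom G "G Mod N" "\<lambda>a. N #> a"
    using assms(1) by (rule group_hom_Mod)
  note Z = central_mod_iff[OF N]
  show "N \<subseteq> central_mod G N"
  proof
    fix u assume "u \<in> N"
    then have "u \<in> carrier G" using N by (meson normal_imp_subgroup subgroup.mem_carrier)
    moreover from this have "N #> u = \<one>\<^bsub>G Mod N\<^esub>"
      using \<open>u \<in> N\<close> r_coset_eq_one_iff[OF N] by blast
    ultimately show "u \<in> central_mod G N" by (simp add: Z)
  qed
  show "central_mod G N \<lhd> G"
    unfolding normal_inv_iff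
  proof (intro conjI ballI)
    show "subgroup (central_mod G N) G"
    proof (rule subgroupI)
      show "inv a \<in> central_mod G N" if "a \<in> central_mod G N" for a
      proof -
        from that have a: "a \<in> carrier G"
          and "\<forall>W\<in>carrier (G Mod N). (N #> a) \<otimes>\<^bsub>G Mod N\<^esub> W = W \<otimes>\<^bsub>G Mod N\<^esub> (N #> a)"
          unfolding Z by blast+
        then have "\<forall>W\<in>carrier (G Mod N).
            inv\<^bsub>G Mod N\<^esub> (N #> a) \<otimes>\<^bsub>G Mod N\<^esub> W = W \<otimes>\<^bsub>G Mod N\<^esub> inv\<^bsub>G Mod N\<^esub> (N #> a)"
          by (intro ballI Q.H.inv_commute) (use a in auto)
        then show ?thesis
          using a unfolding Z Q.hom_inv[OF a] by blast
      qed
      show "a \<otimes> b \<in> central_mod G N" if "a \<in> central_mod G N" "b \<in> central_mod G N" for a b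
      proof -
        from that have ab: "a \<in> carrier G" "b \<in> carrier G"
          and "\<forall>W\<in>carrier (G Mod N). (N #> a) \<otimes>\<^bsub>G Mod N\<^esub> W = W \<otimes>\<^bsub>G Mod N\<^esub> (N #> a)"
            "\<forall>W\<in>carrier (G Mod N). (N #> b) \<otimes>\<^bsub>G Mod N\<^esub> W = W \<otimes>\<^bsub>G Mod N\<^esub> (N #> b)"
          unfolding Z by blast+
        then have "\<forall>W\<in>carrier (G Mod N). (N #> a) \<otimes>\<^bsub>G Mod N\<^esub> (N #> b) \<otimes>\<^bsub>G Mod N\<^esub> W =
            W \<otimes>\<^bsub>G Mod N\<^esub> ((N #> a) \<otimes>\<^bsub>G Mod N\<^esub> (N #> b))"
          by (intro ballI Q.H.mult_commute) (use ab in auto)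
        then show ?thesis
          using ab unfolding Z Q.hom_mult[OF ab] by blast
      qed
      have "\<one> \<in> central_mod G N" by (simp add: Z)
      then show "central_mod G N \<noteq> {}" by blast
    qed (auto simp: central_mod_def)
    fix x h assume x: "x \<in> carrier G" and h: "h \<in> central_mod G N"
    then have hG: "h \<in> carrier G" and hx: "(N #> h) \<otimes>\<^bsub>G Mod N\<^esub> (N #> x) = (N #> x) \<otimes>\<^bsub>G Mod N\<^esub> (N #> h)"
      unfolding Z using Q.hom_closed by blast+
    \<comment> \<open>The cosets of \<open>h\<close> and \<open>x\<close> commute, so conjugation by
      \<open>x\<close> fixes the coset of \<open>h\<close>.\<close>
    have "N #> (x \<otimes> h \<otimes> inv x) = N #> h"
      using x hG by (simp add: Q.H.m_assoc flip: hx)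
    then show "x \<otimes> h \<otimes> inv x \<in> central_mod G N"
      using h x hG unfolding Z by (metis inv_closed m_closed)
  qed
qed

text \<open>The images of \<open>x\<close> and \<open>y\<close> in \<open>G Mod N\<close> have a
  central commutator, which is trivial by \<open>coprime_pow_commute_if_central\<close>. This is one
  step down the upper central series.\<close>

lemma coprime_pow_commutator_in_normal:
  fixes m l :: nat
  assumes N: "N \<lhd> G" and xy: "x \<in> carrier G" "y \<in> carrier G"
    and "x [^] m = \<one>" "y [^] l = \<one>" "coprime m l"
    and central: "commutator G x y \<in> central_mod G N"
  shows "commutator G x y \<in> N"
proof -
  interpret Q: group_hom G "G Mod N" "\<lambda>a. N #> a"
    using assms(1) by (rule group_hom_Mod)
  have comm: "N #> commutator G x y = commutator (G Mod N) (N #> x) (N #> y)"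
    using xy unfolding commutator_def by simp
  have "commutator (G Mod N) (N #> x) (N #> y) = \<one>\<^bsub>G Mod N\<^esub>"
  proof (rule Q.H.coprime_pow_commute_if_central)
    show "(N #> x) [^]\<^bsub>G Mod N\<^esub> m = \<one>\<^bsub>G Mod N\<^esub>" "(N #> y) [^]\<^bsub>G Mod N\<^esub> l = \<one>\<^bsub>G Mod N\<^esub>"
      using assms by (simp_all flip: Q.hom_nat_pow)
  qed (use xy central \<open>coprime m l\<close> in \<open>auto simp: central_mod_iff[OF N] simp flip: comm\<close>)
  then show ?thesis
    using r_coset_eq_one_iff[OF N] xy by (simp flip: comm)
qed

lemma normal_upper_central: "upper_central G n \<lhd> G"
  by (induction n) (simp_all add: normal_central_mod one_is_normal)

text \<open>The commutator lies in the last term of the upper central series and is pushed down one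
  term at a time until it lies in the trivial subgroup.\<close>

lemma coprime_pow_commute:
  fixes m l :: nat
  assumes xy: "x \<in> carrier G" "y \<in> carrier G" "x [^] m = \<one>" "y [^] l = \<one>" "coprime m l"
    and nilp: "upper_central G n = carrier G"
  shows "x \<otimes> y = y \<otimes> x"
proof -
  have "commutator G x y \<in> upper_central G k \<Longrightarrow> commutator G x y = \<one>" for k
  proof (induction k)
    case (Suc k)
    have "commutator G x y \<in> upper_central G k"
      by (rule coprime_pow_commutator_in_normal[OF normal_upper_central xy])
        (use Suc.prems in simp)
    then show ?case by (rule Suc.IH)
  qed simp
  from this[of n] show ?thesis
    using nilp xy(1,2) by (simp add: commutator_eq_one_iff)
qed

section \<open>Central elements of p-groups and Sylow subgroups\<close>

text \<open>Class equation: conjugation orbits have p-power size, and those of size one are the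
  central elements. Were the identity the only one, the order would be 1 modulo
  \<open>p\<close>.\<close>

lemma p_group_center:
  assumes p: "prime p" and ord: "order G = p ^ b" and "b > 0"
  obtains z where "z \<in> carrier G" "z \<noteq> \<one>" "\<And>x. x \<in> carrier G \<Longrightarrow> x \<otimes> z = z \<otimes> x"
proof (rule ccontr)
  assume no: "\<not> thesis"
  \<comment> \<open>Later \<open>if\<close> clauses rebind \<open>that\<close>. Together with
    \<open>no\<close>, this fact says that every central element is the identity.\<close>
  note intro = that
  let ?\<phi> = "\<lambda>g. \<lambda>h\<in>carrier G. g \<otimes> h \<otimes> inv g"
  let ?orbs = "orbits G (carrier G) ?\<phi>"
  interpret A: group_action G "carrier G" ?\<phi>
    by (rule action_by_conjugation)
  have fin: "finite (carrier G)"
    using ord p by (metis card.infinite not_prime_0 order_def power_not_zero)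
  have orb1: "orbit G ?\<phi> \<one> = {\<one>}"
    unfolding orbit_def by force
  have fin_orbs: "finite (?orbs)"
    using fin by (simp add: orbits_def setcompr_eq_image)
  have dvd: "p dvd card K" if K: "K \<in> ?orbs - {{\<one>}}" for K
  proof -
    have "\<exists>x. x \<in> carrier G \<and> K = orbit G ?\<phi> x"
      using K unfolding orbits_def by fast
    then obtain x where x: "x \<in> carrier G" "K = orbit G ?\<phi> x"
      by (elim exE conjE)
    have "card K dvd p ^ b"
      using A.orbit_stabilizer_theorem[OF x(1)] unfolding x(2)[symmetric] ord by (rule dvdI[OF sym])
    moreover have "card K \<noteq> 1"
    proof
      assume "card K = 1"
      then have K1: "K = {x}"
        using A.orbit_refl[OF x(1)] x(2) by (metis card_1_singletonE singletonD)
      have "g \<otimes> x = x \<otimes> g" if g: "g \<in> carrier G" for g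
      proof -
        have "g \<otimes> x \<otimes> inv g \<in> K"
          unfolding x(2) orbit_def using g x(1) by auto
        then have "g \<otimes> x \<otimes> inv g = x" using K1 by simp
        then show ?thesis using g x(1) by (simp add: inv_solve_right')
      qed
      with x(1) have "x = \<one>" using no intro[of x] by fast
      then show False using K K1 by simp
    qed
    moreover obtain a where a: "card K = p ^ a"
      using divides_primepow_nat[OF p] \<open>card K dvd p ^ b\<close> by blast
    ultimately show ?thesis by (cases a) simp_all
  qed
  have one_orb: "{\<one>} \<in> ?orbs"
    unfolding orbits_def using orb1 by (intro CollectI exI[of _ \<one>]) simp
  have "p ^ b = (\<Sum>K\<in>?orbs. card K)"
    using A.disjoint_sum[OF fin, of "\<lambda>_. 1::nat"] ord by (simp add: order_def)
  also have "\<dots> = 1 + (\<Sum>K\<in>?orbs - {{\<one>}}. card K)"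
    using sum.remove[OF fin_orbs one_orb, of card] by simp
  finally have "p ^ b = 1 + (\<Sum>K\<in>?orbs - {{\<one>}}. card K)" .
  then have "1 = p ^ b - (\<Sum>K\<in>?orbs - {{\<one>}}. card K)" by simp
  moreover have "p dvd p ^ b - (\<Sum>K\<in>?orbs - {{\<one>}}. card K)"
    using \<open>b > 0\<close> by (intro dvd_diff_nat dvd_power dvd_sum dvd disjI1)
  ultimately have "p dvd 1" by (simp only:)
  then show False using p by simp
qed

text \<open>\<open>G Mod N\<close> is a nontrivial p-group, and any representative of a nontrivial
  central coset will do.\<close>

lemma p_group_central_mod:
  assumes "prime p" and ord: "order G = p ^ a" and N: "N \<lhd> G" and "N \<noteq> carrier G"
  obtains z where "z \<in> central_mod G N" "z \<notin> N"
proof -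
  interpret Q: group_hom G "G Mod N" "\<lambda>a. N #> a"
    using N by (rule group_hom_Mod)
  have lagr: "order (G Mod N) * card N = p ^ a"
    using lagrange[OF normal_imp_subgroup[OF N]] unfolding ord by (simp add: order_def FactGroup_def)
  then obtain b where b: "order (G Mod N) = p ^ b"
    using divides_primepow_nat[OF \<open>prime p\<close>] by (metis dvd_triv_left)
  have "b > 0"
  proof (rule ccontr)
    assume "\<not> b > 0"
    with b lagr have "card N = card (carrier G)" by (simp add: ord flip: order_def)
    moreover have "finite (carrier G)"
      using ord \<open>prime p\<close> by (metis card.infinite not_prime_0 order_def power_not_zero)
    moreover have "N \<subseteq> carrier G"
      using N by (simp add: normal_imp_subgroup subgroup.subset)
    ultimately show False using \<open>N \<noteq> carrier G\<close> by (metis card_subset_eq)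
  qed
  then obtain Z where Z: "Z \<in> carrier (G Mod N)" "Z \<noteq> \<one>\<^bsub>G Mod N\<^esub>"
    and comm: "\<And>X. X \<in> carrier (G Mod N) \<Longrightarrow> X \<otimes>\<^bsub>G Mod N\<^esub> Z = Z \<otimes>\<^bsub>G Mod N\<^esub> X"
    using Q.H.p_group_center[OF \<open>prime p\<close> b] by metis
  from Z(1) obtain z where z: "z \<in> carrier G" "Z = N #> z"
    by (auto simp: carrier_FactGroup)
  have "z \<in> central_mod G N"
    unfolding central_mod_iff[OF N] by (intro conjI ballI z(1)) (simp only: comm flip: z(2))
  moreover have "z \<notin> N"
    using Z(2) z r_coset_eq_one_iff[OF N] by blast
  ultimately show thesis by (rule that)
qed

text \<open>The set is the preimage of the centralizer of \<open>N #> z\<close> in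
  \<open>G Mod N\<close>.\<close>

lemma subgroup_commutator_in_normal:
  assumes N: "N \<lhd> G" and z: "z \<in> carrier G"
  shows "subgroup {g \<in> carrier G. commutator G z g \<in> N} G"
proof -
  interpret Q: group_hom G "G Mod N" "\<lambda>a. N #> a"
    using N by (rule group_hom_Mod)
  let ?Z = "N #> z"
  have eq: "{g \<in> carrier G. commutator G z g \<in> N} =
      {g \<in> carrier G. (N #> g) \<otimes>\<^bsub>G Mod N\<^esub> ?Z = ?Z \<otimes>\<^bsub>G Mod N\<^esub> (N #> g)}"
    using commutator_in_normal_iff[OF N z] by auto
  show ?thesis
    unfolding eq
  proof (rule subgroupI)
    have "\<one> \<in> {g \<in> carrier G. (N #> g) \<otimes>\<^bsub>G Mod N\<^esub> ?Z = ?Z \<otimes>\<^bsub>G Mod N\<^esub> (N #> g)}"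
      using z Q.hom_one Q.hom_closed by simp
    then show "{g \<in> carrier G. (N #> g) \<otimes>\<^bsub>G Mod N\<^esub> ?Z = ?Z \<otimes>\<^bsub>G Mod N\<^esub> (N #> g)} \<noteq> {}"
      by blast
  next
    fix a assume "a \<in> {g \<in> carrier G. (N #> g) \<otimes>\<^bsub>G Mod N\<^esub> ?Z = ?Z \<otimes>\<^bsub>G Mod N\<^esub> (N #> g)}"
    note a = CollectD[OF this, THEN conjunct1] CollectD[OF this, THEN conjunct2]
    have "(N #> inv a) \<otimes>\<^bsub>G Mod N\<^esub> ?Z = ?Z \<otimes>\<^bsub>G Mod N\<^esub> (N #> inv a)"
      unfolding Q.hom_inv[OF a(1)] by (intro Q.H.inv_commute a(2) Q.hom_closed a(1) z)
    then show "inv a \<in> {g \<in> carrier G. (N #> g) \<otimes>\<^bsub>G Mod N\<^esub> ?Z = ?Z \<otimes>\<^bsub>G Mod N\<^esub> (N #> g)}"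
      using a(1) by (intro CollectI conjI inv_closed)
    fix b assume "b \<in> {g \<in> carrier G. (N #> g) \<otimes>\<^bsub>G Mod N\<^esub> ?Z = ?Z \<otimes>\<^bsub>G Mod N\<^esub> (N #> g)}"
    note b = CollectD[OF this, THEN conjunct1] CollectD[OF this, THEN conjunct2]
    have "(N #> (a \<otimes> b)) \<otimes>\<^bsub>G Mod N\<^esub> ?Z = ?Z \<otimes>\<^bsub>G Mod N\<^esub> (N #> (a \<otimes> b))"
      unfolding Q.hom_mult[OF a(1) b(1)] by (intro Q.H.mult_commute a(2) b(2) Q.hom_closed a(1) b(1) z)
    then show "a \<otimes> b \<in> {g \<in> carrier G. (N #> g) \<otimes>\<^bsub>G Mod N\<^esub> ?Z = ?Z \<otimes>\<^bsub>G Mod N\<^esub> (N #> g)}"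
      using a(1) b(1) by (intro CollectI conjI m_closed)
  qed blast
qed

lemma card_subgroup_dvd:
  assumes "subgroup H G" "subgroup K G" "H \<subseteq> K"
  shows "card H dvd card K"
proof -
  interpret K: group "G\<lparr>carrier := K\<rparr>"
    using assms(2) by (rule subgroup_imp_group)
  show ?thesis
    using K.lagrange[OF subgroup_incl[OF assms]] by (simp add: order_def) (metis dvd_triv_right)
qed

lemma subgroup_pow_card_eq_one:
  assumes "subgroup H G" "x \<in> H"
  shows "x [^] card H = \<one>"
proof -
  interpret H: group "G\<lparr>carrier := H\<rparr>"
    using assms(1) by (rule subgroup_imp_group)
  show ?thesis
    using H.pow_order_eq_1[of x] assms(2) by (simp add: order_def flip: nat_pow_consistent)
qed

text \<open>If \<open>N\<close> were proper, a Sylow subgroup \<open>P\<close> for a prime dividing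
  the index would contain some \<open>z\<close> outside \<open>N\<close> that is central in
  \<open>P\<close> modulo \<open>N\<close>. By coprimality \<open>z\<close> also commutes with Sylow
  subgroups for the other primes. So the centralizer \<open>?D\<close> of \<open>z\<close> modulo
  \<open>N\<close> is everything, and \<open>z\<close> contradicts \<open>sub\<close>.\<close>

lemma central_mod_subset_imp_eq_carrier:
  assumes fin: "finite (carrier G)" and N: "N \<lhd> G" and sub: "central_mod G N \<subseteq> N"
    and coprime_comm: "\<And>x y (m::nat) l. \<lbrakk>x \<in> carrier G; y \<in> carrier G; x [^] m = \<one>; y [^] l = \<one>;
      coprime m l\<rbrakk> \<Longrightarrow> x \<otimes> y = y \<otimes> x"
  shows "N = carrier G"
proof (rule ccontr)
  assume "N \<noteq> carrier G"
  have N': "subgroup N G" "N \<subseteq> carrier G"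
    using N by (simp_all add: normal_imp_subgroup subgroup.subset)
  have ord0: "order G \<noteq> 0"
    using fin by (metis card_eq_0_iff empty_iff one_closed order_def)
  have lagr: "card (rcosets N) * card N = order G"
    by (rule lagrange[OF N'(1)])
  have "card (rcosets N) \<noteq> 1"
  proof
    assume "card (rcosets N) = 1"
    with lagr have "card N = card (carrier G)" by (simp add: order_def)
    with fin N' \<open>N \<noteq> carrier G\<close> show False by (metis card_subset_eq)
  qed
  then obtain p where p: "prime p" "p dvd card (rcosets N)"
    using prime_factor_nat by blast
  define a where "a = multiplicity p (order G)"
  \<comment> \<open>With a multiplicity as exponent, primes not dividing the order are covered too;
    their subgroup is trivial.\<close>
  have sylow: "\<exists>P. subgroup P G \<and> card P = q ^ multiplicity q (order G)" if "prime q" for q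
  proof -
    obtain m where "order G = q ^ multiplicity q (order G) * m"
      using multiplicity_dvd by (rule dvdE)
    then show ?thesis by (rule sylow_thm[OF that is_group _ fin])
  qed
  obtain P where P: "subgroup P G" "card P = p ^ a"
    using sylow[OF p(1)] by (auto simp: a_def)
  interpret P: group "G\<lparr>carrier := P\<rparr>"
    using P(1) by (rule subgroup_imp_group)
  \<comment> \<open>Otherwise the full power of \<open>p\<close> in the order divides
    \<open>card N\<close>, and the factor \<open>p\<close> of the index gives one power too
    many.\<close>
  have NP: "N \<inter> P \<noteq> P"
  proof
    assume "N \<inter> P = P"
    then have "P \<subseteq> N" by blast
    then have "p ^ a dvd card N"
      using card_subgroup_dvd[OF P(1) N'(1)] P(2) by simp
    with p(2) have "p ^ Suc a dvd order G"
      unfolding lagr[symmetric] by (simp add: mult_dvd_mono)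
    then have "Suc a \<le> a"
      unfolding a_def using p(1) not_prime_unit by (intro multiplicity_geI[OF ord0]) auto
    then show False by simp
  qed
  obtain z where zP: "z \<in> central_mod (G\<lparr>carrier := P\<rparr>) (N \<inter> P)" and "z \<notin> N \<inter> P"
    using P.p_group_central_mod[OF p(1) _ normal_Int_subgroup[OF P(1) N]] NP P(2)
    by (auto simp: order_def)
  have zinP: "z \<in> P" and zG: "z \<in> carrier G" and "z \<notin> N"
    using zP \<open>z \<notin> N \<inter> P\<close> subgroup.subset[OF P(1)] by (auto simp: central_mod_def)
  let ?D = "{g \<in> carrier G. commutator G z g \<in> N}"
  have D: "subgroup ?D G"
    by (rule subgroup_commutator_in_normal[OF N zG])
  have sub_D: "\<exists>Q. subgroup Q G \<and> Q \<subseteq> ?D \<and> card Q = q ^ multiplicity q (order G)" if q: "prime q" for q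
  proof (cases "q = p")
    case True
    have "P \<subseteq> ?D"
    proof
      fix g assume "g \<in> P"
      then have "commutator (G\<lparr>carrier := P\<rparr>) z g \<in> N"
        using zP by (simp add: central_mod_def)
      then show "g \<in> ?D"
        using \<open>g \<in> P\<close> zinP subgroup.subset[OF P(1)]
        by (auto simp: commutator_def m_inv_consistent[OF P(1)])
    qed
    with P True show ?thesis by (intro exI[of _ P]) (simp add: a_def)
  next
    case False
    obtain Q where Q: "subgroup Q G" "card Q = q ^ multiplicity q (order G)"
      using sylow[OF q] by auto
    have "Q \<subseteq> ?D"
    proof
      fix g assume "g \<in> Q"
      then have g: "g \<in> carrier G" using Q(1) by (meson subgroup.mem_carrier)
      have "coprime (card P) (card Q)"
        unfolding P(2) Q(2) using False p(1) q by (simp add: primes_coprime)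
      then have "z \<otimes> g = g \<otimes> z"
        by (rule coprime_comm[OF zG g subgroup_pow_card_eq_one[OF P(1) zinP]
              subgroup_pow_card_eq_one[OF Q(1) \<open>g \<in> Q\<close>]])
      then have "commutator G z g = \<one>"
        by (simp only: commutator_eq_one_iff[OF zG g])
      then show "g \<in> ?D"
        using g subgroup.one_closed[OF N'(1)] by simp
    qed
    with Q show ?thesis by (intro exI[of _ Q] conjI)
  qed
  have "order G dvd card ?D"
  proof (rule multiplicity_le_imp_dvd)
    fix q :: nat assume q: "prime q"
    obtain Q where Q: "subgroup Q G" "Q \<subseteq> ?D" "card Q = q ^ multiplicity q (order G)"
      using sub_D[OF q] by (elim exE conjE)
    then have "q ^ multiplicity q (order G) dvd card ?D"
      using card_subgroup_dvd[OF Q(1) D Q(2)] by (simp only: Q(3))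
    moreover have "card ?D \<noteq> 0"
      using fin subgroup.one_closed[OF D] by (auto simp: card_eq_0_iff)
    ultimately show "multiplicity q (order G) \<le> multiplicity q (card ?D)"
      using q not_prime_unit by (intro multiplicity_geI) auto
  qed (rule ord0)
  moreover have "card ?D \<le> order G" "card ?D > 0"
    using fin subgroup.one_closed[OF D] by (auto simp: order_def card_gt_0_iff intro!: card_mono)
  ultimately have "card ?D = card (carrier G)"
    using dvd_imp_le unfolding order_def by (metis le_antisym)
  then have "?D = carrier G"
    using fin by (intro card_subset_eq) auto
  then have "\<forall>g\<in>carrier G. commutator G z g \<in> N" by blast
  with zG have "z \<in> central_mod G N" by (simp add: central_mod_def)
  with sub \<open>z \<notin> N\<close> show False by blast
qed

text \<open>The upper central series ascends in a finite set, so it is stationary at a term of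
  maximal cardinality. That term contains its own relative centre and hence is the whole
  group.\<close>

theorem nilpotent_if_coprime_pow_commute:
  assumes fin: "finite (carrier G)"
    and coprime_comm: "\<And>x y (m::nat) l. \<lbrakk>x \<in> carrier G; y \<in> carrier G; x [^] m = \<one>; y [^] l = \<one>;
      coprime m l\<rbrakk> \<Longrightarrow> x \<otimes> y = y \<otimes> x"
  shows "\<exists>n. upper_central G n = carrier G"
proof -
  have sub: "upper_central G n \<subseteq> carrier G" for n
    using normal_upper_central normal_imp_subgroup subgroup.subset by blast
  have "\<forall>n. card (upper_central G n) < Suc (card (carrier G))"
    using fin sub by (simp add: card_mono less_Suc_eq_le)
  then obtain n where n: "\<And>m. card (upper_central G m) \<le> card (upper_central G n)"
    using ex_has_greatest_nat[of "\<lambda>_. True" 0 "\<lambda>n. card (upper_central G n)"] by blast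
  have "upper_central G n = upper_central G (Suc n)"
  proof (rule card_seteq)
    show "finite (upper_central G (Suc n))" using fin sub finite_subset by blast
    show "upper_central G n \<subseteq> upper_central G (Suc n)"
      using normal_central_mod(2)[OF normal_upper_central] by simp
  qed (rule n)
  then have "central_mod G (upper_central G n) \<subseteq> upper_central G n" by simp
  then have "upper_central G n = carrier G"
    by (rule central_mod_subset_imp_eq_carrier[OF fin normal_upper_central]) (rule coprime_comm)
  then show ?thesis ..
qed

end

section \<open>Malcev sequences\<close>

context group
begin

text \<open>One Malcev step turns the quotient of the two terms into its commutator with
  \<open>b \<otimes> w\<close>, which ties the Malcev recursion to the upper central series.\<close>

lemma commutator_divide:
  assumes "a \<in> carrier G" "b \<in> carrier G" "w \<in> carrier G"
  shows "(a \<otimes> w \<otimes> b) \<otimes> inv (b \<otimes> w \<otimes> a) = commutator G (a \<otimes> inv b) (b \<otimes> w)"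
proof -
  have cancel: "inv b \<otimes> (b \<otimes> c) = c" if "c \<in> carrier G" for c
    using assms(2) that by (simp flip: m_assoc)
  show ?thesis
    using assms by (simp add: commutator_def inv_mult_group m_assoc cancel)
qed

lemma upper_central_Suc_iff:
  "u \<in> upper_central G (Suc n) \<longleftrightarrow>
    u \<in> carrier G \<and> (\<forall>v\<in>carrier G. commutator G u v \<in> upper_central G n)"
  unfolding funpow.simps comp_apply by (subst central_mod_def) simp

text \<open>By \<open>commutator_divide\<close>, each step moves the quotient of the two terms down
  one term of the upper central series.\<close>

lemma malcev_sequences_meet:
  assumes "\<And>k. l k \<in> carrier G" "\<And>k. r k \<in> carrier G" "\<And>k. w k \<in> carrier G"
    and "\<And>k. l (Suc k) = l k \<otimes> w k \<otimes> r k" "\<And>k. r (Suc k) = r k \<otimes> w k \<otimes> l k"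
    and "l 0 \<otimes> inv (r 0) \<in> upper_central G n"
  shows "l n = r n"
  using assms
proof (induction n arbitrary: l r w)
  case 0
  then show ?case by (metis funpow_0 inv_equality inv_inv inv_closed singletonD)
next
  case (Suc n)
  have "commutator G (l 0 \<otimes> inv (r 0)) (r 0 \<otimes> w 0) \<in> upper_central G n"
    using Suc.prems(6) Suc.prems(1-3) unfolding upper_central_Suc_iff by blast
  then have "l 1 \<otimes> inv (r 1) \<in> upper_central G n"
    using Suc.prems commutator_divide by simp
  then show ?case
    using Suc.IH[of "\<lambda>k. l (Suc k)" "\<lambda>k. r (Suc k)" "\<lambda>k. w (Suc k)"] Suc.prems by simp
qed

end

text \<open>The first step, not the last, is split off and absorbed into the starting pair; this
  suits inductions on the length in which the pair varies.\<close>

lemma malcev_shift: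
  "malcev_lambda a b z (Suc n) = malcev_lambda (a * z 1 * b) (b * z 1 * a) (\<lambda>i. z (Suc i)) n"
  "malcev_rho a b z (Suc n) = malcev_rho (a * z 1 * b) (b * z 1 * a) (\<lambda>i. z (Suc i)) n"
proof (induction n)
  case (Suc n)
  case 1 then show ?case using Suc by simp
  case 2 then show ?case using Suc by simp
qed simp_all

lemma malcev_cong:
  assumes "\<And>i. i \<in> {1..n} \<Longrightarrow> z i = z' i"
  shows "malcev_lambda a b z n = malcev_lambda a b z' n" "malcev_rho a b z n = malcev_rho a b z' n"
  using assms by (induction n) simp_all

lemma malcev_eq_mono:
  assumes "malcev_lambda a b z n = malcev_rho a b z n" "n \<le> m"
  shows "malcev_lambda a b z m = malcev_rho a b z m"
  using assms(2,1) by (induction rule: dec_induct) simp_all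

text \<open>A converse to \<open>malcev_sequences_meet\<close>. The commutator of
  \<open>a \<otimes> inv b\<close> with any \<open>v\<close> is the quotient after one Malcev step
  with multiplier \<open>inv b \<otimes> v\<close>, so induction on \<open>n\<close>
  applies.\<close>

lemma malcev_nilpotent_imp_upper_central:
  fixes G :: "('a::semigroup_mult, 'b) monoid_scheme" (structure)
  assumes "group G" and mult: "\<And>x y. x \<otimes> y = x * y"
    and "a \<in> carrier G" "b \<in> carrier G"
    and "\<And>z. (\<And>i. z i \<in> carrier G) \<Longrightarrow> malcev_lambda a b z n = malcev_rho a b z n"
  shows "a \<otimes> inv b \<in> upper_central G n"
proof -
  interpret group G by fact
  show ?thesis
    using assms(3-)
  proof (induction n arbitrary: a b)
    case 0
    from "0.prems"(3)[of "\<lambda>_. a"] "0.prems" show ?case by simp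
  next
    case (Suc n)
    have "commutator G (a \<otimes> inv b) v \<in> upper_central G n" if v: "v \<in> carrier G" for v
    proof -
      define w where "w = inv b \<otimes> v"
      have w: "w \<in> carrier G" "b \<otimes> w = v"
        using Suc.prems v by (simp_all add: w_def flip: m_assoc)
      have "(a \<otimes> w \<otimes> b) \<otimes> inv (b \<otimes> w \<otimes> a) \<in> upper_central G n"
      proof (rule Suc.IH)
        fix z assume z: "z i \<in> carrier G" for i :: nat
        show "malcev_lambda (a \<otimes> w \<otimes> b) (b \<otimes> w \<otimes> a) z n = malcev_rho (a \<otimes> w \<otimes> b) (b \<otimes> w \<otimes> a) z n"
        proof -
          \<comment> \<open>This puts \<open>w\<close> in front of \<open>z\<close>. The value at
            index 0 is a default inside the carrier, as the recursion reads from index 1.\<close>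
          let ?z = "\<lambda>i. if i \<le> 1 then w else z (i - 1)"
          have "malcev_lambda a b ?z (Suc n) = malcev_rho a b ?z (Suc n)"
            using z w by (intro Suc.prems(3)) simp
          moreover have "(\<lambda>i. ?z (Suc i)) = z(0 := w)" by auto
          ultimately show ?thesis
            using malcev_cong[of n z "z(0 := w)" "a * w * b" "b * w * a"]
            unfolding malcev_shift by (simp add: mult)
        qed
      qed (use Suc.prems(1,2) w(1) in simp_all)
      then show ?thesis
        by (simp only: commutator_divide[OF Suc.prems(1,2) w(1), unfolded w(2)] w(2))
    qed
    then show ?case
      using Suc.prems unfolding upper_central_Suc_iff by simp
  qed
qed

text \<open>Nilpotency with the \<open>z i\<close> taken from \<open>T\<close> itself: this needs no adjoined identity and passes
  to subsets.\<close>

definition nilpotent_within :: "'a::semigroup_mult set \<Rightarrow> bool" where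
  "nilpotent_within T \<longleftrightarrow> (\<exists>n. \<forall>a\<in>T. \<forall>b\<in>T. \<forall>z. (\<forall>i. z i \<in> T) \<longrightarrow>
    malcev_lambda a b z n = malcev_rho a b z n)"

lemma generated_mult:
  "a \<in> generated X \<Longrightarrow> b \<in> generated X \<Longrightarrow> a * b \<in> generated X"
  by (auto simp: hull_def subsemigroup_def)

lemma generated_pow:
  fixes a :: "'a::monoid_mult"
  assumes "a \<in> generated X" "n > 0"
  shows "a ^ n \<in> generated X"
  using assms(2)
proof (induction n rule: nat_induct_non_zero)
  case (Suc n)
  then show ?case using generated_mult[OF assms(1)] by (simp only: power_Suc)
qed (use assms(1) in simp)

lemma nilpotent_withinD:
  assumes "nilpotent_within T" "a \<in> T" "b \<in> T" "\<And>i. z i \<in> T"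
  shows "\<exists>n. malcev_lambda a b z n = malcev_rho a b z n"
  using assms unfolding nilpotent_within_def by blast

lemma nilpotent_within_subset: "nilpotent_within T \<Longrightarrow> U \<subseteq> T \<Longrightarrow> nilpotent_within U"
  unfolding nilpotent_within_def by (meson subsetD)

section \<open>Finite monoids with nilpotent two-generated subsemigroups\<close>

text \<open>Supplies the premises of \<open>idempotents_linked\<close>. Here \<open>p\<close> is an
  idempotent L-equivalent to \<open>x\<close>, \<open>q\<close> is one R-equivalent to
  \<open>y\<close>, and \<open>x * w * y\<close> is R-equivalent to \<open>x\<close> and
  L-equivalent to \<open>y\<close>.\<close>

lemma link_premises:
  fixes p :: "'a::semigroup_mult"
  assumes p: "p = s1 * x" "x * p = x" and q: "q = y * s2" "q * y = y"
    and x: "x = x * w * y * u" and y: "y = v * (x * w * y)"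
  shows "p * w * q * (y * u) = p" "v * x * p * w * q = q"
proof -
  have "p * w * q * (y * u) = s1 * (x * w * (q * y) * u)" by (simp add: p(1) mult.assoc)
  also have "\<dots> = p" using x by (simp add: p(1) q(2))
  finally show "p * w * q * (y * u) = p" .
  have "v * x * p * w * q = v * ((x * p) * w * y) * s2" by (simp add: q(1) mult.assoc)
  also have "\<dots> = q" using y by (simp add: p(2) q(1))
  finally show "v * x * p * w * q = q" .
qed

locale two_generated_nilpotent =
  fixes S :: "'a::monoid_mult set"
  assumes fin: "finite S"
    and one_closed: "1 \<in> S"
    and mult_closed: "x \<in> S \<Longrightarrow> y \<in> S \<Longrightarrow> x * y \<in> S"
    and nil: "x \<in> S \<Longrightarrow> y \<in> S \<Longrightarrow> nilpotent_within (generated {x, y})"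
begin

lemma pow_closed: "x \<in> S \<Longrightarrow> x ^ n \<in> S"
  by (induction n) (simp_all add: one_closed mult_closed)

section \<open>Zero bands and links between idempotents\<close>

text \<open>In a right zero band the Malcev sequences with constant multiplier \<open>p\<close> swap
  their values at every step.\<close>

lemma right_zero_eq:
  assumes "p \<in> S" "q \<in> S" "p * q = q" "q * p = p"
  shows "p = q"
proof -
  let ?T = "generated {p, q}"
  have pp: "p * p = p" using assms(3,4) by (metis mult.assoc)
  have pq: "p \<in> ?T" "q \<in> ?T" by (simp_all add: hull_inc)
  have "(malcev_lambda p q (\<lambda>_. p) n = p \<and> malcev_rho p q (\<lambda>_. p) n = q) \<or>
        (malcev_lambda p q (\<lambda>_. p) n = q \<and> malcev_rho p q (\<lambda>_. p) n = p)" for n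
    by (induction n) (auto simp: assms pp)
  then show ?thesis
    using nilpotent_withinD[OF nil[OF assms(1,2)] pq, of "\<lambda>_. p"] pq by metis
qed

text \<open>In a left zero band both Malcev sequences are constant.\<close>

lemma left_zero_eq:
  assumes "p \<in> S" "q \<in> S" "p * q = p" "q * p = q"
  shows "p = q"
proof -
  let ?T = "generated {p, q}"
  have pp: "p * p = p" using assms(3,4) by (metis mult.assoc)
  have qq: "q * q = q" using assms(3,4) by (metis mult.assoc)
  have pq: "p \<in> ?T" "q \<in> ?T" by (simp_all add: hull_inc)
  have "malcev_lambda p q (\<lambda>_. p) n = p \<and> malcev_rho p q (\<lambda>_. p) n = q" for n
    by (induction n) (auto simp: assms pp qq)
  then show ?thesis
    using nilpotent_withinD[OF nil[OF assms(1,2)] pq, of "\<lambda>_. p"] pq by metis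
qed

text \<open>The element \<open>v = q * s * p\<close> satisfies \<open>p * w * v = p\<close> and
  \<open>v * w * q = q\<close>. So \<open>w * v\<close> and \<open>p\<close> form a left zero band,
  \<open>v * w\<close> and \<open>q\<close> a right zero band, and both pairs collapse.\<close>

lemma idempotents_linked:
  assumes S: "p \<in> S" "q \<in> S" "w \<in> S" "s \<in> S" and "p * p = p" "q * q = q"
    and p: "p * w * q * s = p" and q: "u * p * w * q = q"
  obtains v where "v \<in> S" "w * v = p" "v * w = q"
proof -
  define v where "v = q * s * p"
  have vS: "v \<in> S" using S by (simp add: v_def mult_closed)
  have qv: "q * v = v" and vp: "v * p = v"
    using assms(5,6) by (simp_all add: v_def mult.assoc) (simp flip: mult.assoc)
  have av: "p * w * v = p"
    using assms(5,6) p unfolding v_def by (metis mult.assoc)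
  have va: "v * w * q = q"
  proof -
    have "q = u * p * w * q" by (rule q[symmetric])
    also have "\<dots> = u * (p * w * v) * w * q" using av assms(5) by (metis mult.assoc)
    also have "\<dots> = v * w * q" using q qv by (metis mult.assoc)
    finally show ?thesis by simp
  qed
  have "w * v = p"
  proof (rule left_zero_eq)
    show "w * v * p = w * v" using vp by (simp add: mult.assoc)
    show "p * (w * v) = p" using av by (simp add: mult.assoc)
  qed (use S vS in \<open>simp_all add: mult_closed\<close>)
  moreover have "v * w = q"
  proof (rule right_zero_eq)
    show "v * w * q = q" by (rule va)
    show "q * (v * w) = v * w" using qv by (simp flip: mult.assoc)
  qed (use S vS in \<open>simp_all add: mult_closed\<close>)
  ultimately show thesis using that vS by blast
qed

text \<open>With \<open>e * v = p\<close> and \<open>v * e = q\<close>, both \<open>p * e\<close>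
  and \<open>e * q\<close> equal \<open>e * v * e\<close>. Then \<open>p\<close> and
  \<open>p * e\<close> form a right zero band, \<open>q\<close> and \<open>e * q\<close> a left zero
  band, so all four coincide.\<close>

lemma idempotents_linked_by_idempotent:
  assumes S: "p \<in> S" "q \<in> S" "e \<in> S" "s \<in> S" and "p * p = p" "q * q = q" "e * e = e"
    and p: "p * e * q * s = p" and q: "u * p * e * q = q"
  shows "p = q" "e * p = p" "p * e = p"
proof -
  obtain v where v: "v \<in> S" "e * v = p" "v * e = q"
    using idempotents_linked[OF S \<open>p * p = p\<close> \<open>q * q = q\<close> p q] .
  have ep: "e * p = p" and qe: "q * e = q"
    using v(2,3) \<open>e * e = e\<close> by (metis mult.assoc)+
  have pe: "p * e = e * q"
    using v(2,3) by (metis mult.assoc)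
  have "p = p * e"
    by (rule right_zero_eq) (use S assms(5) ep in \<open>simp_all add: mult_closed mult.assoc\<close>, simp flip: mult.assoc)
  moreover have "q = e * q"
    by (rule left_zero_eq) (use S assms(6) qe in \<open>simp_all add: mult_closed mult.assoc\<close>, simp flip: mult.assoc)
  ultimately show "p = q" "e * p = p" "p * e = p" using pe ep by simp_all
qed


section \<open>Maximal subgroups\<close>

text \<open>For idempotent \<open>f\<close> this is the group of units of the local monoid
  \<open>f S f\<close>. The witness \<open>b\<close> ranges over \<open>S\<close>; the inverse in
  the group is \<open>f * b * f\<close>.\<close>

definition unit_group :: "'a \<Rightarrow> 'a monoid" where
  "unit_group f = \<lparr>carrier = {a \<in> S. f * a = a \<and> a * f = a \<and> (\<exists>b\<in>S. a * b = f \<and> b * a = f)},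
     monoid.mult = (*), one = f\<rparr>"

lemma unit_group_simps [simp]:
  "a \<otimes>\<^bsub>unit_group f\<^esub> b = a * b" "\<one>\<^bsub>unit_group f\<^esub> = f"
  by (simp_all add: unit_group_def)

lemma in_unit_groupI:
  assumes "a \<in> S" "f * a = a" "a * f = a" "b \<in> S" "a * b = f" "b * a = f"
  shows "a \<in> carrier (unit_group f)"
  using assms by (auto simp: unit_group_def)

lemma in_unit_groupD:
  assumes "a \<in> carrier (unit_group f)"
  shows "a \<in> S" "f * a = a" "a * f = a" "\<exists>b\<in>S. a * b = f \<and> b * a = f"
  using assms by (auto simp: unit_group_def)

lemma group_unit_group:
  assumes f: "f \<in> S" "f * f = f"
  shows "group (unit_group f)"
proof (rule groupI)
  fix a assume a: "a \<in> carrier (unit_group f)"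
  then obtain b where b: "b \<in> S" "a * b = f" "b * a = f"
    using in_unit_groupD(4) by blast
  have "f * b * f \<in> carrier (unit_group f)"
  proof (rule in_unit_groupI)
    show "f * b * f * a = f" using in_unit_groupD(2)[OF a] b f by (metis mult.assoc)
    show "a * (f * b * f) = f" using in_unit_groupD(3)[OF a] b f by (metis mult.assoc)
    show "f * (f * b * f) = f * b * f" "f * b * f * f = f * b * f"
      using f by (metis mult.assoc)+
  qed (use f b in_unit_groupD(1)[OF a] in \<open>simp_all add: mult_closed\<close>)
  moreover have "f * b * f * a = f"
    using in_unit_groupD(2)[OF a] b f by (metis mult.assoc)
  ultimately show "\<exists>c\<in>carrier (unit_group f). c \<otimes>\<^bsub>unit_group f\<^esub> a = \<one>\<^bsub>unit_group f\<^esub>"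
    by auto
  show "\<one>\<^bsub>unit_group f\<^esub> \<otimes>\<^bsub>unit_group f\<^esub> a = a"
    using in_unit_groupD(2)[OF a] by simp
  fix c assume c: "c \<in> carrier (unit_group f)"
  then obtain d where d: "d \<in> S" "c * d = f" "d * c = f"
    using in_unit_groupD(4) by blast
  have "a * c \<in> carrier (unit_group f)"
  proof (rule in_unit_groupI)
    show "f * (a * c) = a * c" using in_unit_groupD(2)[OF a] by (simp flip: mult.assoc)
    show "a * c * f = a * c" using in_unit_groupD(3)[OF c] by (simp add: mult.assoc)
    show "a * c * (d * b) = f" using in_unit_groupD(3)[OF a] b(2) d(2) by (metis mult.assoc)
    show "d * b * (a * c) = f" using in_unit_groupD(2)[OF c] b(3) d(3) by (metis mult.assoc)
  qed (use b d in_unit_groupD(1)[OF a] in_unit_groupD(1)[OF c] in \<open>simp_all add: mult_closed\<close>)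
  then show "a \<otimes>\<^bsub>unit_group f\<^esub> c \<in> carrier (unit_group f)" by simp
qed (use f in \<open>auto intro: in_unit_groupI simp: mult.assoc\<close>)

text \<open>In a finite group the subsemigroup generated by \<open>x\<close> and \<open>y\<close> is
  a subgroup. Malcev nilpotency makes its upper central series reach the top, and
  \<open>coprime_pow_commute\<close> applies.\<close>

lemma unit_group_coprime_commute:
  fixes m l :: nat
  assumes f: "f \<in> S" "f * f = f"
    and x: "x \<in> carrier (unit_group f)" and y: "y \<in> carrier (unit_group f)"
    and xy: "x [^]\<^bsub>unit_group f\<^esub> m = f" "y [^]\<^bsub>unit_group f\<^esub> l = f" "coprime m l"
  shows "x * y = y * x"
proof -
  interpret G: group "unit_group f" by (rule group_unit_group[OF f])
  let ?T = "generated {x, y}"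
  have fin_G: "finite (carrier (unit_group f))"
    using fin by (simp add: unit_group_def)
  have T: "?T \<subseteq> carrier (unit_group f)"
    using x y G.m_closed by (intro hull_minimal) (auto simp: subsemigroup_def)
  have xT: "x \<in> ?T" and yT: "y \<in> ?T" by (simp_all add: hull_inc)
  have pow: "a [^]\<^bsub>unit_group f\<^esub> Suc k \<in> ?T" if "a \<in> ?T" for a k
    using that T in_unit_groupD(2)[of a f] by (induction k) (auto simp: generated_mult subsetD)
  have sub: "subgroup ?T (unit_group f)"
  proof (rule G.subgroupI[OF T])
    show "?T \<noteq> {}" using xT by blast
    fix a assume a: "a \<in> ?T"
    let ?o = "order (unit_group f)"
    have aG: "a \<in> carrier (unit_group f)" using a T by blast
    have o: "?o > 0" using fin_G aG by (auto simp: order_def card_gt_0_iff)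
    \<comment> \<open>The inverse is a power with exponent \<open>2 * ?o - 1\<close>, which is
      positive even in the trivial group, as \<open>pow\<close> requires.\<close>
    then have "Suc (Suc (2 * ?o - 2)) = 2 * ?o" by simp
    then have "a [^]\<^bsub>unit_group f\<^esub> Suc (2 * ?o - 2) \<otimes>\<^bsub>unit_group f\<^esub> a = a [^]\<^bsub>unit_group f\<^esub> (2 * ?o)"
      by (metis G.nat_pow_Suc)
    also have "\<dots> = \<one>\<^bsub>unit_group f\<^esub>"
      using G.pow_order_eq_1[OF aG] aG f(2) by (simp add: mult_2 flip: G.nat_pow_mult)
    finally have "inv\<^bsub>unit_group f\<^esub> a = a [^]\<^bsub>unit_group f\<^esub> Suc (2 * ?o - 2)"
      by (rule G.inv_equality[OF _ aG G.nat_pow_closed[OF aG]])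
    then show "inv\<^bsub>unit_group f\<^esub> a \<in> ?T" using pow[OF a] by metis
  qed (simp add: generated_mult)
  let ?H = "unit_group f\<lparr>carrier := ?T\<rparr>"
  interpret H: group ?H by (rule G.subgroup_imp_group[OF sub])
  have "nilpotent_within ?T"
    using nil in_unit_groupD(1) x y by blast
  then obtain n where n: "\<And>a b z. a \<in> ?T \<Longrightarrow> b \<in> ?T \<Longrightarrow> (\<And>i. z i \<in> ?T) \<Longrightarrow>
      malcev_lambda a b z n = malcev_rho a b z n"
    unfolding nilpotent_within_def by blast
  have "a \<in> upper_central ?H n" if "a \<in> ?T" for a
  proof -
    \<comment> \<open>Pairing \<open>a\<close> with the identity makes the quotient equal to
      \<open>a\<close>.\<close>
    have "a \<otimes>\<^bsub>?H\<^esub> inv\<^bsub>?H\<^esub> \<one>\<^bsub>?H\<^esub> \<in> upper_central ?H n"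
      by (rule malcev_nilpotent_imp_upper_central)
        (use that H.is_group n H.one_closed in simp_all)
    then show ?thesis using that H.inv_one H.r_one[of a] by simp
  qed
  moreover have "upper_central ?H n \<subseteq> carrier ?H"
    using H.normal_upper_central normal_imp_subgroup subgroup.subset by blast
  ultimately have "upper_central ?H n = carrier ?H" by auto
  then have "x \<otimes>\<^bsub>?H\<^esub> y = y \<otimes>\<^bsub>?H\<^esub> x"
    using xT yT xy by (intro H.coprime_pow_commute[of _ _ m l]) (simp_all flip: G.nat_pow_consistent)
  then show ?thesis by simp
qed

lemma unit_group_sequences_meet:
  assumes f: "f \<in> S" "f * f = f"
    and "l 0 \<in> carrier (unit_group f)" "r 0 \<in> carrier (unit_group f)"
      "\<And>k. w k \<in> carrier (unit_group f)"
    and rec: "\<And>k. l (Suc k) = l k * w k * r k" "\<And>k. r (Suc k) = r k * w k * l k"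
  shows "\<exists>k. l k = r k"
proof -
  interpret G: group "unit_group f" by (rule group_unit_group[OF f])
  have lr: "l k \<in> carrier (unit_group f) \<and> r k \<in> carrier (unit_group f)" for k
  proof (induction k)
    case (Suc k)
    then have "l k \<otimes>\<^bsub>unit_group f\<^esub> w k \<otimes>\<^bsub>unit_group f\<^esub> r k \<in> carrier (unit_group f)"
      "r k \<otimes>\<^bsub>unit_group f\<^esub> w k \<otimes>\<^bsub>unit_group f\<^esub> l k \<in> carrier (unit_group f)"
      using assms(5) by blast+
    then show ?case by (simp add: rec)
  qed (use assms in simp)
  have "\<exists>n. upper_central (unit_group f) n = carrier (unit_group f)"
  proof (rule G.nilpotent_if_coprime_pow_commute)
    show "finite (carrier (unit_group f))" using fin by (simp add: unit_group_def)
    fix x y and i j :: nat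
    assume "x \<in> carrier (unit_group f)" "y \<in> carrier (unit_group f)" "coprime i j"
      "x [^]\<^bsub>unit_group f\<^esub> i = \<one>\<^bsub>unit_group f\<^esub>" "y [^]\<^bsub>unit_group f\<^esub> j = \<one>\<^bsub>unit_group f\<^esub>"
    then show "x \<otimes>\<^bsub>unit_group f\<^esub> y = y \<otimes>\<^bsub>unit_group f\<^esub> x"
      unfolding unit_group_simps by (intro unit_group_coprime_commute[OF f])
  qed
  then obtain n where n: "upper_central (unit_group f) n = carrier (unit_group f)" ..
  have "l n = r n"
  proof (rule G.malcev_sequences_meet[where w = w])
    show "l 0 \<otimes>\<^bsub>unit_group f\<^esub> inv\<^bsub>unit_group f\<^esub> r 0 \<in> upper_central (unit_group f) n"
      unfolding n using lr G.inv_closed G.m_closed by blast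
  qed (use lr rec assms(5) in auto)
  then show ?thesis ..
qed

text \<open>With multipliers alternating between \<open>d\<close> and a power of \<open>d\<close>,
  the sequences run from \<open>(f, g)\<close> to \<open>(f * d, g * d)\<close> and back, so they
  never meet unless \<open>f = g\<close>.\<close>

lemma swap_not_nilpotent:
  assumes S: "f \<in> S" "g \<in> S" "d \<in> S" and "f * f = f" "g * g = g"
    and swap: "f * d = d * g" "g * d = d * f"
    and t: "t > 0" "f * d ^ t = f" "g * d ^ t = g"
  shows "f = g"
proof -
  let ?T = "generated {f, d}"
  have fT: "f \<in> ?T" and dT: "d \<in> ?T" by (simp_all add: hull_inc)
  have T_pow: "d ^ k \<in> ?T" if "k > 0" for k
    using generated_pow[OF dT that] .
  have f_pow: "f * d ^ (t * k) = f" and g_pow: "g * d ^ (t * k) = g" for k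
    by (induction k) (simp_all add: t power_add flip: mult.assoc)
  \<comment> \<open>Moving past \<open>d\<close> exchanges \<open>f\<close> and \<open>g\<close>, so
    even powers of \<open>d\<close> commute with both.\<close>
  have pow_comm: "f * d ^ (2 * k) = d ^ (2 * k) * f" "g * d ^ (2 * k) = d ^ (2 * k) * g" for k
    using swap by (induction k) (simp_all, metis mult.assoc, metis mult.assoc)
  \<comment> \<open>With this exponent \<open>d * d ^ ?M * d\<close> fixes \<open>f\<close> and \<open>g\<close>, and it is positive even for \<open>t = 1\<close>.\<close>
  let ?M = "4 * t - 2"
  define z where "z i = (if odd i then d else d ^ ?M)" for i :: nat
  have zT: "z i \<in> ?T" for i
    using t(1) by (simp add: z_def dT T_pow)
  have "4 * t = Suc (Suc ?M)" using t(1) by simp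
  then have dM: "d * d ^ ?M * d = d ^ (t * 4)"
    by (metis power_Suc power_Suc2 mult.commute)
  \<comment> \<open>The second sequence starts at \<open>g\<close>, which must therefore be shown to
    be generated by \<open>f\<close> and \<open>d\<close>.\<close>
  have "g = g * d ^ (t * 2)" by (rule g_pow[symmetric])
  also have "\<dots> = d ^ (t * 2) * g" using pow_comm(2)[of t] by (simp add: mult.commute)
  also have "\<dots> = d ^ (2 * t - 1) * (f * d)"
    using t(1) swap(1) power_Suc2[of d "2 * t - 1"] by (simp add: mult.assoc mult.commute)
  also have "\<dots> \<in> ?T"
    using t(1) by (intro generated_mult T_pow fT dT) simp
  finally have gT: "g \<in> ?T" .
  have lr1: "f * d * g = f * d" "g * d * f = g * d"
    using swap assms(4,5) by (metis mult.assoc)+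
  have lr2: "f * d * d ^ ?M * (g * d) = f" "g * d * d ^ ?M * (f * d) = g"
  proof -
    have "f * d * d ^ ?M * (g * d) = f * (d * d ^ ?M * d) * f"
      by (simp add: swap(2) mult.assoc)
    then show "f * d * d ^ ?M * (g * d) = f"
      using assms(4) by (simp add: dM f_pow flip: mult.assoc)
    have "g * d * d ^ ?M * (f * d) = g * (d * d ^ ?M * d) * g"
      by (simp add: swap(1) mult.assoc)
    then show "g * d * d ^ ?M * (f * d) = g"
      using assms(5) by (simp add: dM g_pow flip: mult.assoc)
  qed
  have even: "malcev_lambda f g z (2 * n) = f \<and> malcev_rho f g z (2 * n) = g" for n
    by (induction n) (simp_all add: z_def lr1 lr2)
  obtain n where "malcev_lambda f g z n = malcev_rho f g z n"
    using nilpotent_withinD[OF nil[OF S(1,3)] fT gT, of z] zT by blast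
  then have "malcev_lambda f g z (2 * n) = malcev_rho f g z (2 * n)"
    by (rule malcev_eq_mono) simp
  with even show ?thesis by simp
qed

section \<open>Periodic Malcev sequences\<close>

text \<open>Two steps expand to a product that begins and ends with \<open>l k\<close>; iterating
  keeps this form.\<close>

lemma malcev_sequence_jump:
  assumes S: "\<And>k. l k \<in> S" "\<And>k. r k \<in> S" "\<And>k. w k \<in> S"
    and rec: "\<And>k. l (Suc k) = l k * w k * r k" "\<And>k. r (Suc k) = r k * w k * l k"
  shows "\<exists>s\<in>S. l (k + 2 * Suc j) = l k * s * l k"
proof (induction j)
  case 0
  have "l (k + 2 * Suc 0) = l k * (w k * r k * w (Suc k) * r k * w k) * l k"
    by (simp add: rec mult.assoc)
  then show ?case by (rule bexI) (intro mult_closed S)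
next
  case (Suc j)
  then obtain s where s: "s \<in> S" "l (k + 2 * Suc j) = l k * s * l k" by blast
  let ?k = "k + 2 * Suc j"
  have "l (k + 2 * Suc (Suc j)) = l ?k * (w ?k * r ?k * w (Suc ?k) * r ?k * w ?k) * l ?k"
    by (simp add: rec mult.assoc)
  also have "\<dots> = l k * (s * l k * (w ?k * r ?k * w (Suc ?k) * r ?k * w ?k) * l k * s) * l k"
    unfolding s(2) by (simp only: mult.assoc)
  finally show ?case by (rule bexI) (intro mult_closed S s(1))
qed

text \<open>Periodicity returns a later term to \<open>l k\<close>, so
  \<open>malcev_sequence_jump\<close> gives regularity. It also shows that \<open>l (Suc k)\<close>
  is R-equivalent to \<open>l k\<close> and L-equivalent to \<open>r k\<close>.\<close>

lemma periodic_malcev_sequence_regular: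
  assumes S: "\<And>k. l k \<in> S" "\<And>k. r k \<in> S" "\<And>k. w k \<in> S"
    and rec: "\<And>k. l (Suc k) = l k * w k * r k" "\<And>k. r (Suc k) = r k * w k * l k"
    and t: "t > 0" "\<And>k. l (k + t) = l k" "\<And>k. r (k + t) = r k"
  shows "\<exists>s\<in>S. l k = l k * s * l k" "\<exists>s\<in>S. l k = l (Suc k) * s" "\<exists>s\<in>S. r k = s * l (Suc k)"
proof -
  have per: "l (k + t * q) = l k" "r (k + t * q) = r k" for k q
  proof (induction q)
    case (Suc q)
    have eq: "k + t * Suc q = k + t * q + t" by simp
    case 1 show ?case unfolding eq t(2) by (rule Suc)
    case 2 show ?case unfolding eq t(3) by (rule Suc)
  qed simp_all
  \<comment> \<open>From \<open>k + 2\<close>, the return is to \<open>k + t * 4\<close>: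
    \<open>2 * t - 1\<close> double steps are positive in number even for
    \<open>t = 1\<close>.\<close>
  have "k + 2 * Suc (t - 1) = k + t * 2" "k + 2 + 2 * Suc (2 * t - 2) = k + t * 4"
    using t(1) by simp_all
  then have l2: "l (k + 2 * Suc (t - 1)) = l k" and l4: "l (k + 2 + 2 * Suc (2 * t - 2)) = l k"
    and r4: "r (k + 2 + 2 * Suc (2 * t - 2)) = r k"
    by (simp_all only: per)
  show "\<exists>s\<in>S. l k = l k * s * l k"
    using malcev_sequence_jump[of l r w, OF S rec, of k "t - 1"] unfolding l2 .
  obtain s where s: "s \<in> S" "l k = l (k + 2) * s * l (k + 2)"
    using malcev_sequence_jump[of l r w, OF S rec, of "k + 2" "2 * t - 2"] unfolding l4 by blast
  then have "l k = l (Suc k) * (w (Suc k) * r (Suc k) * s * l (k + 2))"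
    by (simp add: rec mult.assoc)
  then show "\<exists>s\<in>S. l k = l (Suc k) * s"
    by (rule bexI) (intro mult_closed S s(1))
  obtain s where s: "s \<in> S" "r k = r (k + 2) * s * r (k + 2)"
    using malcev_sequence_jump[of r l w, OF S(2,1,3) rec(2,1), of "k + 2" "2 * t - 2"] unfolding r4 by blast
  then have "r k = (r (k + 2) * s * r (Suc k) * w (Suc k)) * l (Suc k)"
    by (simp add: rec mult.assoc)
  then show "\<exists>s\<in>S. r k = s * l (Suc k)"
    by (rule bexI) (intro mult_closed S s(1))
qed

text \<open>The sequences start in the periodic part, at an index whose multiplier is the idempotent
  \<open>e\<close>; the next multiplier is \<open>d\<close>. These two steps give all relations
  between the idempotents.\<close>

lemma periodic_malcev_sequences_meet:
  assumes S: "\<And>k. l k \<in> S" "\<And>k. r k \<in> S" "e \<in> S" "d \<in> S"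
    and e: "e * e = e" "e * d = d" "d * e = d"
    and rec: "\<And>k. l (Suc k) = l k * (e * d ^ k) * r k" "\<And>k. r (Suc k) = r k * (e * d ^ k) * l k"
    and t: "t > 0" "\<And>k. l (k + t) = l k" "\<And>k. r (k + t) = r k" "d ^ t = e"
  shows "\<exists>k. l k = r k"
proof -
  let ?w = "\<lambda>k. e * d ^ k"
  have wS: "?w k \<in> S" for k using S by (simp add: pow_closed mult_closed)
  note L = periodic_malcev_sequence_regular[of l r ?w, OF S(1,2) wS rec t(1-3)]
  note R = periodic_malcev_sequence_regular[of r l ?w, OF S(2,1) wS rec(2,1) t(1,3,2)]
  obtain sx where sx: "sx \<in> S" "l 0 = l 0 * sx * l 0" using L(1) by blast
  obtain sy where sy: "sy \<in> S" "r 0 = r 0 * sy * r 0" using R(1) by blast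
  \<comment> \<open>\<open>f\<close> and \<open>f'\<close> are idempotents R-equivalent to
    \<open>l 0\<close> and \<open>r 0\<close>; \<open>g\<close> and \<open>g'\<close> are
    L-equivalent to them.\<close>
  define f where "f = l 0 * sx"
  define g where "g = sx * l 0"
  define f' where "f' = r 0 * sy"
  define g' where "g' = sy * r 0"
  have fgS: "f \<in> S" "g \<in> S" "f' \<in> S" "g' \<in> S"
    using sx(1) sy(1) S by (simp_all add: f_def g_def f'_def g'_def mult_closed)
  have idem: "f * f = f" "g * g = g" "f' * f' = f'" "g' * g' = g'"
    unfolding f_def g_def f'_def g'_def using sx(2) sy(2) by (metis mult.assoc)+
  have fix0: "f * l 0 = l 0" "l 0 * g = l 0" "f' * r 0 = r 0" "r 0 * g' = r 0"
    using sx(2) sy(2) by (simp_all add: f_def g_def f'_def g'_def mult.assoc)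
  have fix1: "l 1 * g' = l 1" "r 1 * g = r 1" "f * l 1 = l 1" "f' * r 1 = r 1"
    using fix0 rec[of 0] by (simp_all add: mult.assoc) (simp_all flip: mult.assoc)
  have rec0: "l (Suc 0) = l 0 * e * r 0" "r (Suc 0) = r 0 * e * l 0"
    and rec1: "l (Suc 1) = l 1 * d * r 1" "r (Suc 1) = r 1 * d * l 1"
    using rec[of 0] rec[of 1] e by simp_all
  \<comment> \<open>The product \<open>l 0 * e * r 0\<close> links \<open>g\<close> to
    \<open>f'\<close>, and they coincide because \<open>e\<close> is idempotent.\<close>
  have link0: "g = f' \<and> e * g = g \<and> g * e = g"
  proof -
    obtain u where u: "u \<in> S" "l 0 = l 0 * e * r 0 * u" using L(2)[of 0] rec0 by auto
    obtain v where v: "r 0 = v * (l 0 * e * r 0)" using L(3)[of 0] rec0 by auto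
    note prems = link_premises[OF g_def fix0(2) f'_def fix0(3) u(2) v]
    show ?thesis
      using idempotents_linked_by_idempotent[OF fgS(2,3) S(3) mult_closed[OF S(2) u(1)] idem(2,3) e(1) prems]
      by blast
  qed
  have link0': "g' = f \<and> e * g' = g' \<and> g' * e = g'"
  proof -
    obtain u where u: "u \<in> S" "r 0 = r 0 * e * l 0 * u" using R(2)[of 0] rec0 by auto
    obtain v where v: "l 0 = v * (r 0 * e * l 0)" using R(3)[of 0] rec0 by auto
    note prems = link_premises[OF g'_def fix0(4) f_def fix0(1) u(2) v]
    show ?thesis
      using idempotents_linked_by_idempotent[OF fgS(4,1) S(3) mult_closed[OF S(1) u(1)] idem(4,1) e(1) prems]
      by blast
  qed
  \<comment> \<open>\<open>l 1\<close> ends in \<open>r 0\<close> and \<open>r 1\<close> begins with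
    it, so the step through \<open>d\<close> links \<open>g'\<close> to \<open>f'\<close>. From
    \<open>d * c = g'\<close> and \<open>c * d = f'\<close>, both \<open>g' * d\<close> and
    \<open>d * f'\<close> equal \<open>d * c * d\<close>.\<close>
  have link1: "f * d = d * g"
  proof -
    obtain u where u: "u \<in> S" "l 1 = l 1 * d * r 1 * u" using L(2)[of 1] rec1 by auto
    obtain v where v: "r 1 = v * (l 1 * d * r 1)" using L(3)[of 1] rec1 by auto
    obtain s where s: "r 0 = s * l 1" using L(3)[of 0] by auto
    obtain s' where s': "r 0 = r 1 * s'" using R(2)[of 0] by auto
    have "g' = (sy * s) * l 1" "f' = r 1 * (s' * sy)"
      unfolding g'_def f'_def using s s' by (metis mult.assoc)+
    note prems = link_premises[OF this(1) fix1(1) this(2) fix1(4) u(2) v]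
    obtain c where "d * c = g'" "c * d = f'"
      using idempotents_linked[OF fgS(4,3) S(4) mult_closed[OF S(2) u(1)] idem(4,3) prems] .
    then show ?thesis using link0 link0' by (metis mult.assoc)
  qed
  have link1': "g * d = d * f"
  proof -
    obtain u where u: "u \<in> S" "r 1 = r 1 * d * l 1 * u" using R(2)[of 1] rec1 by auto
    obtain v where v: "l 1 = v * (r 1 * d * l 1)" using R(3)[of 1] rec1 by auto
    obtain s where s: "l 0 = s * r 1" using R(3)[of 0] by auto
    obtain s' where s': "l 0 = l 1 * s'" using L(2)[of 0] by auto
    have "g = (sx * s) * r 1" "f = l 1 * (s' * sx)"
      unfolding g_def f_def using s s' by (metis mult.assoc)+
    note prems = link_premises[OF this(1) fix1(2) this(2) fix1(3) u(2) v]
    obtain c where "d * c = g" "c * d = f"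
      using idempotents_linked[OF fgS(2,1) S(4) mult_closed[OF S(1) u(1)] idem(2,1) prems] .
    then show ?thesis by (metis mult.assoc)
  qed
  have ef: "f * e = f" "g * e = g" using link0 link0' by auto
  have fg: "f = g"
    using swap_not_nilpotent[OF fgS(1,2) S(4) idem(1,2) link1 link1' t(1)] ef t(4) by simp
  have fd: "f * d = d * f" using link1 fg by simp
  have f_w: "f * ?w k * f = f * ?w k" for k
  proof (induction k)
    case 0
    then show ?case using ef idem(1) by simp
  next
    case (Suc k)
    have "f * ?w (Suc k) = f * ?w k * d" by (simp only: power_Suc2 mult.assoc)
    also have "\<dots> = f * ?w k * (f * d)" using Suc by (simp flip: mult.assoc)
    also have "\<dots> = f * ?w k * d * f" unfolding fd by (simp only: mult.assoc)
    also have "\<dots> = f * ?w (Suc k) * f" by (simp only: power_Suc2 mult.assoc)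
    finally show ?case ..
  qed
  \<comment> \<open>The inverse is \<open>d ^ (t * 2 - 1) * f\<close>, since
    \<open>d ^ (t * 2) = e\<close> acts as an identity on \<open>f\<close>.\<close>
  have unit_d: "f * d \<in> carrier (unit_group f)"
  proof (rule in_unit_groupI)
    have dt: "d * d ^ (t * 2 - 1) = d ^ (t * 2)" "d ^ (t * 2 - 1) * d = d ^ (t * 2)"
      using t(1) by (simp_all flip: power_Suc power_Suc2)
    have d2: "d ^ (t * 2) = e" using e(1) by (simp add: power_mult t(4) power2_eq_square)
    show "f * (f * d) = f * d" using idem(1) by (simp flip: mult.assoc)
    show "f * d * f = f * d" using idem(1) fd by (metis mult.assoc)
    show "f * d * (d ^ (t * 2 - 1) * f) = f"
      using dt d2 ef idem(1) by (metis mult.assoc)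
    show "d ^ (t * 2 - 1) * f * (f * d) = f"
      using dt d2 ef idem(1) fd link0' by (metis mult.assoc)
  qed (use fgS S in \<open>simp_all add: mult_closed pow_closed\<close>)
  interpret G: group "unit_group f" by (rule group_unit_group[OF fgS(1) idem(1)])
  have unit_w: "f * ?w k \<in> carrier (unit_group f)" for k
  proof (induction k)
    case 0
    then show ?case using ef G.one_closed by simp
  next
    case (Suc k)
    have "f * ?w (Suc k) = f * ?w k * f * d"
      unfolding f_w by (simp only: power_Suc2 mult.assoc)
    then show ?case using G.m_closed[OF Suc unit_d] by (simp add: mult.assoc)
  qed
  have unit_l: "l 0 \<in> carrier (unit_group f)"
  proof (rule in_unit_groupI)
    show "l 0 * sx = f" "sx * l 0 = f" using fg by (simp_all add: f_def g_def)
  qed (use fix0 fg S sx in simp_all)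
  have unit_r: "r 0 \<in> carrier (unit_group f)"
  proof (rule in_unit_groupI)
    show "r 0 * sy = f" "sy * r 0 = f" using fg link0 link0' by (simp_all add: f'_def g'_def)
  qed (use fix0 fg link0 link0' S sy in simp_all)
  \<comment> \<open>This lets the multipliers \<open>?w k\<close> be replaced by
    \<open>f * ?w k\<close>, which lie in the group.\<close>
  have lr_f: "l k * f = l k \<and> r k * f = r k" for k
  proof (induction k)
    case 0
    then show ?case using unit_l unit_r in_unit_groupD(3) by blast
  next
    case (Suc k)
    then show ?case by (simp add: rec mult.assoc)
  qed
  show ?thesis
  proof (rule unit_group_sequences_meet[where l = l and r = r and w = "\<lambda>k. f * ?w k", OF fgS(1) idem(1) unit_l unit_r unit_w])
    show "l (Suc k) = l k * (f * ?w k) * r k" "r (Suc k) = r k * (f * ?w k) * l k" for k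
      using lr_f[of k] by (simp_all add: rec flip: mult.assoc)
  qed
qed

text \<open>The triple \<open>st k\<close> determines its successor and takes finitely many values,
  so it is eventually periodic.\<close>

lemma engel_sequences_meet:
  assumes S: "\<And>k. l k \<in> S" "\<And>k. r k \<in> S" "c \<in> S"
    and rec: "\<And>k. l (Suc k) = l k * c ^ Suc k * r k" "\<And>k. r (Suc k) = r k * c ^ Suc k * l k"
  shows "\<exists>k. l k = r k"
proof -
  define st where "st k = (l k, r k, c ^ Suc k)" for k
  have "range st \<subseteq> S \<times> S \<times> S"
    using S pow_closed[OF S(3)] by (auto simp: st_def simp del: power_Suc)
  then have "finite (range st)"
    using fin by (meson finite_SigmaI finite_subset)
  then have "\<not> inj st"
    using range_inj_infinite by blast
  then obtain i j where ij: "i < j" "st i = st j"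
    by (metis injI linorder_neqE_nat)
  define t where "t = j - i"
  have t: "t > 0" using ij by (simp add: t_def)
  have per: "st (k + t) = st k" if "i \<le> k" for k
    using that
  proof (induction rule: dec_induct)
    case base
    then show ?case using ij by (simp add: t_def)
  next
    case (step k)
    then have "l (k + t) = l k" "r (k + t) = r k" "c ^ Suc (k + t) = c ^ Suc k"
      by (simp_all add: st_def del: power_Suc)
    moreover from this(3) have "c ^ Suc (Suc (k + t)) = c ^ Suc (Suc k)"
      by (metis power_Suc)
    ultimately show ?case
      by (simp add: st_def rec del: power_Suc)
  qed
  have c_per: "c ^ (m + t * q) = c ^ m" if "Suc i \<le> m" for m q
  proof (induction q)
    case (Suc q)
    have "Suc i \<le> m + t * q" using that by simp
    then obtain k where k: "m + t * q = Suc k" "i \<le> k"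
      by (metis Suc_le_D Suc_le_mono)
    have "m + t * Suc q = Suc (k + t)" using k(1) by simp
    then have "c ^ (m + t * Suc q) = c ^ Suc (k + t)" by (simp only:)
    also have "\<dots> = c ^ m"
      using per[OF k(2)] Suc k(1) by (simp add: st_def del: power_Suc)
    finally show ?case .
  qed simp
  \<comment> \<open>A multiple of the period beyond the preperiod, which makes \<open>c ^ N\<close>
    idempotent.\<close>
  define N where "N = t * Suc i"
  have N: "Suc i \<le> N" using t by (cases t) (simp_all add: N_def)
  define e where "e = c ^ N"
  define d where "d = c ^ Suc N"
  have "e * e = c ^ (N + t * Suc i)" "e * d = c ^ (Suc N + t * Suc i)" "d * e = c ^ (Suc N + t * Suc i)"
    unfolding e_def d_def power_add[symmetric] by (simp_all only: N_def add.commute)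
  then have e: "e * e = e" "e * d = d" "d * e = d"
    using c_per[of N "Suc i"] c_per[of "Suc N" "Suc i"] N by (simp_all only: e_def d_def le_SucI)
  have w: "e * d ^ k = c ^ (N + k)" for k
  proof -
    have "e * d ^ k = c ^ (N + k + t * (Suc i * k))"
      by (simp add: e_def d_def N_def algebra_simps flip: power_add power_mult del: power_Suc)
    also have "\<dots> = c ^ (N + k)" using N by (intro c_per) simp
    finally show ?thesis .
  qed
  have dt: "d ^ t = e"
  proof -
    have "Suc N * t = N + t * (N - i)"
      using N by (simp add: N_def diff_mult_distrib2 add.commute)
    then have "d ^ t = c ^ (N + t * (N - i))"
      by (metis d_def power_mult)
    also have "\<dots> = e" unfolding e_def using N by (rule c_per)
    finally show ?thesis .
  qed
  \<comment> \<open>The multiplier at index \<open>k\<close> is \<open>c ^ Suc k\<close>, so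
    starting at \<open>N - 1\<close> makes the first multiplier \<open>e\<close>.\<close>
  have Suc_N: "Suc (N - 1 + k) = N + k" for k using N by simp
  have "\<exists>k. l (N - 1 + k) = r (N - 1 + k)"
  proof (rule periodic_malcev_sequences_meet[OF _ _ _ _ e _ _ t _ _ dt])
    show "e \<in> S" "d \<in> S" unfolding e_def d_def by (rule pow_closed[OF S(3)])+
    show "l (N - 1 + Suc k) = l (N - 1 + k) * (e * d ^ k) * r (N - 1 + k)"
      "r (N - 1 + Suc k) = r (N - 1 + k) * (e * d ^ k) * l (N - 1 + k)" for k
      using rec[of "N - 1 + k"] unfolding w Suc_N add_Suc_right by blast+
    show "l (N - 1 + (k + t)) = l (N - 1 + k)" "r (N - 1 + (k + t)) = r (N - 1 + k)" for k
      using per[of "N - 1 + k"] N by (simp_all add: st_def add.assoc)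
  qed (rule S)+
  then show ?thesis by blast
qed

end

section \<open>Passing to the adjoined identity\<close>

text \<open>Centralizers are closed under products, so commuting spreads from the generators to one
  argument and then to the other.\<close>

lemma generated_commute:
  assumes xy: "x * y = y * x" and ab: "a \<in> generated {x, y}" "b \<in> generated {x, y}"
  shows "a * b = b * a"
proof -
  have sub: "subsemigroup {b. a * b = b * a}" if "a * x = x * a" for a x :: 'a
    using that unfolding subsemigroup_def by (auto simp: mult.assoc) (metis mult.assoc)
  have "generated {x, y} \<subseteq> {b. x * b = b * x}" "generated {x, y} \<subseteq> {b. y * b = b * y}"
    using xy by (intro hull_minimal sub[of _ x]; simp)+
  with ab(1) have "generated {x, y} \<subseteq> {b. a * b = b * a}"
    by (intro hull_minimal sub[of _ x]) auto
  with ab(2) show ?thesis by blast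
qed

lemma nilpotent_within_generated_commute:
  assumes "x * y = y * x"
  shows "nilpotent_within (generated {x, y})"
proof -
  have "a * z * b = b * z * a"
    if "a \<in> generated {x, y}" "b \<in> generated {x, y}" "z \<in> generated {x, y}" for a b z
    using generated_commute[OF assms] that by (metis mult.assoc)
  then show ?thesis
    unfolding nilpotent_within_def by (intro exI[of _ 1]) simp
qed

lemma nilpotent_within_if_nilpotent:
  assumes "nilpotent T"
  shows "nilpotent_within (Elt ` T)"
proof -
  have sub: "Elt ` T \<subseteq> with_one T" by (auto simp: with_one_def)
  obtain n where n: "\<And>a b c. a \<in> T \<Longrightarrow> b \<in> T \<Longrightarrow> (\<And>i. c i \<in> with_one T) \<Longrightarrow>
      malcev_lambda (Elt a) (Elt b) c n = malcev_rho (Elt a) (Elt b) c n"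
    using assms unfolding nilpotent_def by blast
  have "malcev_lambda x y z n = malcev_rho x y z n"
    if "x \<in> Elt ` T" "y \<in> Elt ` T" "\<And>i. z i \<in> Elt ` T" for x y z
    using that n[of _ _ z] sub by blast
  then show ?thesis
    unfolding nilpotent_within_def by blast
qed

lemma subsemigroup_generated: "X \<noteq> {} \<Longrightarrow> subsemigroup (generated X)"
  using hull_subset[of X] generated_mult unfolding subsemigroup_def by blast

lemma generated_Elt_subset: "generated {Elt x, Elt y} \<subseteq> Elt ` generated {x, y}"
proof (rule hull_minimal)
  show "{Elt x, Elt y} \<subseteq> Elt ` generated {x, y}" by (simp add: hull_inc)
  show "subsemigroup (Elt ` generated {x, y})"
    using subsemigroup_generated[of "{x, y}"] by (auto simp: subsemigroup_def)
qed

text \<open>\<open>One\<close> is adjoined even if \<open>S\<close> has an identity, so one monoid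
  contains \<open>with_one S\<close> in both cases. Pairs containing \<open>One\<close> commute; the
  others are images of pairs in \<open>S\<close>.\<close>

lemma two_generated_nilpotent_adjoin:
  fixes S :: "'a::semigroup_mult set"
  assumes "subsemigroup S" "finite S" "\<forall>x\<in>S. \<forall>y\<in>S. nilpotent (generated {x, y})"
  shows "two_generated_nilpotent (insert One (Elt ` S))"
proof
  fix x y assume xy: "x \<in> insert One (Elt ` S)" "y \<in> insert One (Elt ` S)"
  show "x * y \<in> insert One (Elt ` S)"
    using xy assms(1) by (auto simp: subsemigroup_def)
  show "nilpotent_within (generated {x, y})"
  proof (cases "x = One \<or> y = One")
    case True
    then show ?thesis
      by (intro nilpotent_within_generated_commute) (metis one_adjoin_def mult_1 mult_1_right)
  next
    case False
    with xy obtain a b where ab: "x = Elt a" "y = Elt b" "a \<in> S" "b \<in> S" by auto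
    then show ?thesis
      using assms(3) nilpotent_within_if_nilpotent nilpotent_within_subset generated_Elt_subset by metis
  qed
qed (use assms(2) in \<open>simp_all add: one_adjoin_def\<close>)

lemma the_one_in_with_one: "the_one T \<in> with_one T"
proof (cases "\<exists>e. is_identity T e")
  case True
  then have "\<exists>!e. is_identity T e"
    unfolding is_identity_def by metis
  then have "is_identity T (THE e. is_identity T e)"
    by (rule theI')
  then have "(THE e. is_identity T e) \<in> T"
    unfolding is_identity_def by blast
  with True show ?thesis
    by (simp add: the_one_def with_one_def)
qed (auto simp: the_one_def with_one_def)

theorem theorem2p6:
  fixes S :: "'a::semigroup_mult set"
  assumes "subsemigroup S" and "finite S"
    and "\<forall>x\<in>S. \<forall>y\<in>S. nilpotent (generated {x, y})"
  shows "positively_engel S"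
proof -
  let ?S = "insert One (Elt ` S)"
  interpret two_generated_nilpotent ?S
    by (rule two_generated_nilpotent_adjoin[OF assms])
  have with_one: "with_one S \<subseteq> ?S"
    by (auto simp: with_one_def)
  let ?eq = "\<lambda>(a, b, c) n. malcev_lambda (Elt a) (Elt b) (engel_seq S c) n = malcev_rho (Elt a) (Elt b) (engel_seq S c) n"
  \<comment> \<open>Equality persists once reached, so each triple is settled eventually, and
    finitely many triples share one \<open>n\<close>.\<close>
  have "eventually (?eq (a, b, c)) sequentially"
    if a: "a \<in> S" and b: "b \<in> S" and c: "c \<in> with_one S" for a b c
  proof -
    let ?z = "engel_seq S c"
    have cS: "c \<in> ?S" using c with_one by blast
    have z: "?z k \<in> ?S" for k
      using the_one_in_with_one[of S] with_one pow_closed[OF cS] by (auto simp: engel_seq_def)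
    have mem: "malcev_lambda (Elt a) (Elt b) ?z n \<in> ?S \<and> malcev_rho (Elt a) (Elt b) ?z n \<in> ?S" for n
      using a b by (induction n) (simp_all only: malcev_lambda.simps malcev_rho.simps mult_closed z, simp_all)
    have rec_z: "?z (Suc (k + 2)) = c ^ Suc k" for k
      by (simp add: engel_seq_def)
    \<comment> \<open>The shift by 2 skips the two identity multipliers; those that follow are
      \<open>c\<close>, \<open>c ^ 2\<close> and so on.\<close>
    have "\<exists>k. malcev_lambda (Elt a) (Elt b) ?z (k + 2) = malcev_rho (Elt a) (Elt b) ?z (k + 2)"
    proof (rule engel_sequences_meet[OF _ _ cS])
      show "malcev_lambda (Elt a) (Elt b) ?z (Suc k + 2) = malcev_lambda (Elt a) (Elt b) ?z (k + 2) *
          c ^ Suc k * malcev_rho (Elt a) (Elt b) ?z (k + 2)" for k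
        by (simp only: add_Suc malcev_lambda.simps rec_z)
      show "malcev_rho (Elt a) (Elt b) ?z (Suc k + 2) = malcev_rho (Elt a) (Elt b) ?z (k + 2) *
          c ^ Suc k * malcev_lambda (Elt a) (Elt b) ?z (k + 2)" for k
        by (simp only: add_Suc malcev_rho.simps rec_z)
    qed (rule mem[THEN conjunct1] mem[THEN conjunct2])+
    then obtain k where "malcev_lambda (Elt a) (Elt b) ?z (k + 2) = malcev_rho (Elt a) (Elt b) ?z (k + 2)"
      by blast
    then show ?thesis
      unfolding eventually_sequentially case_prod_conv by (blast intro: malcev_eq_mono)
  qed
  then have "\<forall>abc\<in>S \<times> S \<times> with_one S. eventually (?eq abc) sequentially"
    by blast
  moreover have "finite (S \<times> S \<times> with_one S)"
    using assms(2) fin finite_subset[OF with_one] by simp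
  ultimately have "eventually (\<lambda>n. \<forall>abc\<in>S \<times> S \<times> with_one S. ?eq abc n) sequentially"
    by (intro eventually_ball_finite) auto
  then obtain m where m: "\<And>n. n \<ge> m \<Longrightarrow> \<forall>abc\<in>S \<times> S \<times> with_one S. ?eq abc n"
    unfolding eventually_sequentially by blast
  show ?thesis
    unfolding positively_engel_def using m[of "max 2 m"] by (intro exI[of _ "max 2 m"]) auto
qed

end
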